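(* Under hypotheses (A) and (B), the essential spectral radius $r_e^*$ of the Jackson network process satisfies $$-\min_{1\le i\le d}\frac{1}{G_{ii}}\bigl(\sqrt{\mu_i}-\sqrt{\nu_i}\bigr)^2\le\log r_e^*.$$
   Context: Jackson network with $d$ queues: arrival rates $\lambda_i\ge0$, service rates $\mu_i>0$, routing matrix $P=(p_{ij})_{i,j=1}^d$ nonnegative with $p_{ii}=0$, $\sum_jp_{ij}\le1$, $p_{i0}=1-\sum_jp_{ij}$. The queue-length process $(Z(t))$ is the continuous-time Markov process on $\mathbb{Z}_+^d$ with jumps $+\epsilon^i$ at rate $\lambda_i$, $-\epsilon^i$ at rate $\mu_ip_{i0}$, $\epsilon^j-\epsilon^i$ at rate $\mu_ip_{ij}$ (jumps that would leave $\mathbb{Z}_+^d$ are suppressed). Hypothesis (A): the kernel $(q(x-y))_{x,y\in\mathbb{Z}^d}$ of these jump rates is irreducible (equivalently: spectral radius of $P$ $<1$, and for every $i$ there are $n,j$ with $\lambda_jp^{(n)}_{ji}>0$). Traffic equations $\nu_j=\lambda_j+\sum_i\nu_ip_{ij}$ then have a unique solution with $\nu_i>0$. Hypothesis (B): $\nu_i<\mu_i$ for all $i$. $G=(I-P)^{-1}$. For finite $E\subset\mathbb{Z}_+^d$ let $\tau_E=\inf\{t>0:Z(t)\in E\}$. The essential spectral radius $r_e^*$ is the infimum of all $r>0$ for which there is a finite $E\subset\mathbb{Z}_+^d$ with $\int_0^\infty r^{-t}\mathbb{P}_x(Z(t)=y,\tau_E>t)\,dt<\infty$ for all $x,y\in\mathbb{Z}_+^d\setminus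 E$. *)

theory Defs
  imports "HOL-Analysis.Analysis"
begin

text \<open>Jackson network with queues indexed by a finite type 'd (d = CARD('d)).
  Arrival rates lam, service rates mu, routing matrix P (entries P$i$j).
  States of the queue-length process are functions 'd \<Rightarrow> nat (= Z_+^d).\<close>

definition p0 :: "real^'d^'d \<Rightarrow> 'd::finite \<Rightarrow> real" where
  "p0 P i = 1 - (\<Sum>j\<in>UNIV. P$i$j)"

definition unitv :: "'d \<Rightarrow> 'd \<Rightarrow> int" where
  "unitv i = (\<lambda>k. if k = i then 1 else 0)"

text \<open>Jump kernel q(z), z in Z^d, of the free (unreflected) random walk.\<close>
definition jump_kernel ::
  "('d::finite \<Rightarrow> real) \<Rightarrow> ('d \<Rightarrow> real) \<Rightarrow> real^'d^'d \<Rightarrow> ('d \<Rightarrow> int) \<Rightarrow> real" where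
  "jump_kernel lam mu P z =
     (\<Sum>i\<in>UNIV. (if z = unitv i then lam i else 0)
              + (if z = (\<lambda>k. - unitv i k) then mu i * p0 P i else 0)
              + (\<Sum>j\<in>UNIV. if j \<noteq> i \<and> z = (\<lambda>k. unitv j k - unitv i k)
                             then mu i * P$i$j else 0))"

text \<open>Hypothesis (A): the kernel (q(y - x))_{x,y in Z^d} is irreducible.\<close>
definition jackson_irreducible ::
  "('d::finite \<Rightarrow> real) \<Rightarrow> ('d \<Rightarrow> real) \<Rightarrow> real^'d^'d \<Rightarrow> bool" where
  "jackson_irreducible lam mu P \<longleftrightarrow>
     (\<forall>x y :: 'd \<Rightarrow> int.
        (x, y) \<in> {(u, v). jump_kernel lam mu P (\<lambda>k. v k - u k) > 0}\<^sup>*)"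

text \<open>Jump rate from x to y (x \<noteq> y) of the queue-length process on Z_+^d
  (jumps leaving Z_+^d are suppressed).\<close>
definition jrate ::
  "('d::finite \<Rightarrow> real) \<Rightarrow> ('d \<Rightarrow> real) \<Rightarrow> real^'d^'d \<Rightarrow> ('d \<Rightarrow> nat) \<Rightarrow> ('d \<Rightarrow> nat) \<Rightarrow> real" where
  "jrate lam mu P x y =
     (\<Sum>i\<in>UNIV. (if y = x(i := x i + 1) then lam i else 0)
              + (if 0 < x i \<and> y = x(i := x i - 1) then mu i * p0 P i else 0)
              + (\<Sum>j\<in>UNIV. if j \<noteq> i \<and> 0 < x i \<and> y = (x(i := x i - 1))(j := x j + 1)
                             then mu i * P$i$j else 0))"

text \<open>Total rate of (non-suppressed) jumps out of x.\<close>
definition outrate ::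
  "('d::finite \<Rightarrow> real) \<Rightarrow> ('d \<Rightarrow> real) \<Rightarrow> real^'d^'d \<Rightarrow> ('d \<Rightarrow> nat) \<Rightarrow> real" where
  "outrate lam mu P x =
     (\<Sum>i\<in>UNIV. lam i + (if 0 < x i then mu i * (p0 P i + (\<Sum>j\<in>UNIV - {i}. P$i$j)) else 0))"

text \<open>Uniformization constant (strictly larger than every total jump rate).\<close>
definition unif_const :: "('d::finite \<Rightarrow> real) \<Rightarrow> ('d \<Rightarrow> real) \<Rightarrow> real" where
  "unif_const lam mu = 1 + (\<Sum>i\<in>UNIV. lam i) + (\<Sum>i\<in>UNIV. mu i)"

text \<open>One-step kernel of the uniformized chain.\<close>
definition unif_kernel ::
  "('d::finite \<Rightarrow> real) \<Rightarrow> ('d \<Rightarrow> real) \<Rightarrow> real^'d^'d \<Rightarrow> ('d \<Rightarrow> nat) \<Rightarrow> ('d \<Rightarrow> nat) \<Rightarrow> real" where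
  "unif_kernel lam mu P x y =
     jrate lam mu P x y / unif_const lam mu
     + (if y = x then 1 - outrate lam mu P x / unif_const lam mu else 0)"

text \<open>n-step kernel of the uniformized chain, restricted to paths whose
  states after step 0 all avoid E.\<close>
primrec taboo_steps ::
  "('d::finite \<Rightarrow> real) \<Rightarrow> ('d \<Rightarrow> real) \<Rightarrow> real^'d^'d \<Rightarrow> ('d \<Rightarrow> nat) set \<Rightarrow> nat
     \<Rightarrow> ('d \<Rightarrow> nat) \<Rightarrow> ('d \<Rightarrow> nat) \<Rightarrow> ennreal" where
  "taboo_steps lam mu P E 0 x y = (if x = y then 1 else 0)"
| "taboo_steps lam mu P E (Suc n) x y =
     (\<integral>\<^sup>+ z. ennreal (unif_kernel lam mu P x z) * indicator (- E) z
              * taboo_steps lam mu P E n z y \<partial>count_space UNIV)"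

text \<open>Taboo transition function P_x(Z(t) = y, tau_E > t), computed by uniformization.\<close>
definition taboo_prob ::
  "('d::finite \<Rightarrow> real) \<Rightarrow> ('d \<Rightarrow> real) \<Rightarrow> real^'d^'d \<Rightarrow> ('d \<Rightarrow> nat) set \<Rightarrow> real
     \<Rightarrow> ('d \<Rightarrow> nat) \<Rightarrow> ('d \<Rightarrow> nat) \<Rightarrow> ennreal" where
  "taboo_prob lam mu P E t x y =
     (\<Sum>n. ennreal (exp (- unif_const lam mu * t) * (unif_const lam mu * t) ^ n / fact n)
           * taboo_steps lam mu P E n x y)"

text \<open>Essential spectral radius r_e^*.\<close>
definition ess_spec_radius ::
  "('d::finite \<Rightarrow> real) \<Rightarrow> ('d \<Rightarrow> real) \<Rightarrow> real^'d^'d \<Rightarrow> real" where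
  "ess_spec_radius lam mu P =
     Inf {r::real. 0 < r \<and>
       (\<exists>E. finite E \<and>
          (\<forall>x y. x \<notin> E \<longrightarrow> y \<notin> E \<longrightarrow>
             (\<integral>\<^sup>+ t. indicator {0..} t * ennreal (r powr (- t)) * taboo_prob lam mu P E t x y
                \<partial>lborel) < \<infinity>))}"

end

theory Submission
  imports Defs
begin

text \<open>
  Let \<open>i\<close> attain the minimum and put \<open>s\<^sub>i = (\<surd>\<mu>\<^sub>i - \<surd>\<nu>\<^sub>i)\<^sup>2 / G\<^sub>i\<^sub>i\<close>. If for every \<open>s > s\<^sub>i\<close> and
  every finite \<open>E\<close> there is a nonzero, finitely supported \<open>f \<ge> 0\<close> vanishing on \<open>E\<close> with
  \<open>L f \<ge> - s f\<close> for the generator \<open>L\<close>, then the taboo semigroup decays no faster than \<open>exp (- s t)\<close> on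
  \<open>f\<close>, so the integrals defining the essential spectral radius diverge for \<open>r \<le> exp (- s)\<close>.

  To find \<open>f\<close>, conjugate \<open>L\<close> with \<open>F x = \<Prod>\<^sub>k \<beta>\<^sub>k ^ x\<^sub>k\<close>, where \<open>\<beta>\<close> is harmonic for the routing chain
  off \<open>i\<close> and \<open>\<beta>\<^sub>i = \<surd>(\<mu>\<^sub>i / \<nu>\<^sub>i)\<close>. As long as queue \<open>i\<close> is busy this gives \<open>- s\<^sub>i\<close> plus the generator of a
  twisted network, in which a linear function with coefficient 1 at \<open>x\<^sub>i\<close> is a martingale. Minimality of
  \<open>i\<close> makes the remaining queues of the twisted network stable, so they admit an
  exponential Lyapunov function \<open>W\<close>. The function \<open>f\<close> is \<open>F\<close> times the positive part of a slowly varying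
  bump of the martingale, centred far away from \<open>E\<close>, minus a small multiple of \<open>W\<close>.
\<close>

section \<open>Uniformization and test functions\<close>

text \<open>\<open>None\<close> stands for the outside world, so that arrivals, departures and transfers are all moves from
  one point of \<^typ>\<open>'d option\<close> to another.\<close>

definition enabled :: "'d option \<Rightarrow> ('d \<Rightarrow> nat) \<Rightarrow> bool" where
  "enabled k x = (case k of None \<Rightarrow> True | Some a \<Rightarrow> 0 < x a)"

definition move :: "'d option \<Rightarrow> 'd option \<Rightarrow> ('d \<Rightarrow> nat) \<Rightarrow> 'd \<Rightarrow> nat" where
  "move k l x =
     (let x' = (case k of None \<Rightarrow> x | Some a \<Rightarrow> x(a := x a - 1))
      in case l of None \<Rightarrow> x' | Some b \<Rightarrow> x'(b := x' b + 1))"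

definition gen ::
  "('d::finite option \<Rightarrow> 'd option \<Rightarrow> real) \<Rightarrow> (('d \<Rightarrow> nat) \<Rightarrow> real) \<Rightarrow> ('d \<Rightarrow> nat) \<Rightarrow> real" where
  "gen q f x = (\<Sum>k\<in>UNIV. \<Sum>l\<in>UNIV. if enabled k x then q k l * (f (move k l x) - f x) else 0)"

definition jackson_rates ::
  "('d::finite \<Rightarrow> real) \<Rightarrow> ('d \<Rightarrow> real) \<Rightarrow> real^'d^'d \<Rightarrow> 'd option \<Rightarrow> 'd option \<Rightarrow> real" where
  "jackson_rates lam mu P k l =
     (case k of
        None \<Rightarrow> (case l of None \<Rightarrow> 0 | Some b \<Rightarrow> lam b)
      | Some a \<Rightarrow> mu a * (case l of None \<Rightarrow> p0 P a | Some b \<Rightarrow> P$a$b))"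

lemma jackson_rates_simps [simp]:
  "jackson_rates lam mu P None None = 0"
  "jackson_rates lam mu P None (Some b) = lam b"
  "jackson_rates lam mu P (Some a) None = mu a * p0 P a"
  "jackson_rates lam mu P (Some a) (Some b) = mu a * P$a$b"
  by (simp_all add: jackson_rates_def)

lemma enabled_simps [simp]: "enabled None x" "enabled (Some a) x \<longleftrightarrow> 0 < x a"
  by (simp_all add: enabled_def)

lemma sum_option_UNIV:
  fixes f :: "'d::finite option \<Rightarrow> 'b::comm_monoid_add"
  shows "(\<Sum>k\<in>UNIV. f k) = f None + (\<Sum>a\<in>UNIV. f (Some a))"
  by (simp add: UNIV_option_conv sum.reindex)

section \<open>One-step kernel of the uniformized chain\<close>

lemma sum_if_eq_finite_support:
  fixes f :: "'b \<Rightarrow> real"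
  assumes "finite S" "\<And>z. z \<notin> S \<Longrightarrow> f z = 0"
  shows "(\<Sum>z\<in>S. (if b \<and> z = a then c else 0) * f z) = (if b then c * f a else 0)"
proof -
  have "(\<Sum>z\<in>S. (if b \<and> z = a then c else 0) * f z) = (\<Sum>z\<in>S. if z = a then (if b then c * f a else 0) else 0)"
    by (intro sum.cong) auto
  also have "\<dots> = (if a \<in> S then (if b then c * f a else 0) else 0)"
    using assms(1) by (simp add: sum.delta)
  finally show ?thesis using assms(2)[of a] by auto
qed

text \<open>\<open>jrate\<close> excludes transfers from a node to itself, while the double sum over
  moves contains them; \<open>diag\<close> gives them rate 0.\<close>

lemma jrate_sum:
  fixes f :: "('d::finite \<Rightarrow> nat) \<Rightarrow> real"
  assumes S: "finite S" "\<And>z. z \<notin> S \<Longrightarrow> f z = 0" and diag: "\<And>i. P$i$i = 0"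
  shows "(\<Sum>z\<in>S. jrate lam mu P x z * f z)
    = (\<Sum>k\<in>UNIV. \<Sum>l\<in>UNIV. if enabled k x then jackson_rates lam mu P k l * f (move k l x) else 0)"
proof -
  have 1: "(\<Sum>z\<in>S. (if z = a then c else 0) * f z) = c * f a" for a c
    using sum_if_eq_finite_support[where b=True, OF S] by simp
  have 2: "(\<Sum>z\<in>S. (if b \<and> z = a then c else 0) * f z) = (if b then c * f a else 0)" for a b c
    by (rule sum_if_eq_finite_support[OF S])
  have 3: "(\<Sum>z\<in>S. (if b' \<and> b \<and> z = a then c else 0) * f z) = (if b' \<and> b then c * f a else 0)" for a b b' c
    using sum_if_eq_finite_support[where b="b' \<and> b", OF S] by (simp add: conj_assoc)
  have "(\<Sum>z\<in>S. jrate lam mu P x z * f z) = (\<Sum>i\<in>UNIV. (\<Sum>z\<in>S. (if z = x(i := x i + 1) then lam i else 0) * f z)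
              + (\<Sum>z\<in>S. (if 0 < x i \<and> z = x(i := x i - 1) then mu i * p0 P i else 0) * f z)
              + (\<Sum>j\<in>UNIV. \<Sum>z\<in>S. (if j \<noteq> i \<and> 0 < x i \<and> z = (x(i := x i - 1))(j := x j + 1)
                             then mu i * P$i$j else 0) * f z))"
    unfolding jrate_def sum_distrib_right distrib_right
    apply (subst sum.swap)
    apply (intro sum.cong refl)
    apply (simp only: sum.distrib)
    apply (subst sum.swap)
    apply simp
    done
  also have "\<dots> = (\<Sum>i\<in>UNIV. lam i * f (x(i := x i + 1))
      + (if 0 < x i then mu i * p0 P i * f (x(i := x i - 1)) else 0)
      + (\<Sum>j\<in>UNIV. if j \<noteq> i \<and> 0 < x i then mu i * P$i$j * f ((x(i := x i - 1))(j := x j + 1)) else 0))"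
    by (simp only: 1 2 3)
  also have "\<dots> = (\<Sum>i\<in>UNIV. lam i * f (move None (Some i) x)
      + (if 0 < x i then mu i * p0 P i * f (move (Some i) None x) else 0)
      + (\<Sum>j\<in>UNIV. if 0 < x i then mu i * P$i$j * f (move (Some i) (Some j) x) else 0))"
  proof (intro sum.cong refl arg_cong2[where f="(+)"])
    fix i j show "(if j \<noteq> i \<and> 0 < x i then mu i * P$i$j * f ((x(i := x i - 1))(j := x j + 1)) else 0)
      = (if 0 < x i then mu i * P$i$j * f (move (Some i) (Some j) x) else 0)"
      by (cases "j = i") (auto simp: move_def diag)
  qed (auto simp: move_def)
  finally show ?thesis
    by (simp add: sum_option_UNIV sum.distrib cong: if_cong)
qed

lemma outrate_eq:
  fixes lam mu :: "'d::finite \<Rightarrow> real"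
  assumes diag: "\<And>i. P$i$i = 0"
  shows "outrate lam mu P x = (\<Sum>k\<in>UNIV. \<Sum>l\<in>UNIV. if enabled k x then jackson_rates lam mu P k l else 0)"
proof -
  have "(\<Sum>j\<in>UNIV - {i}. P$i$j) = (\<Sum>j\<in>UNIV. P$i$j)" for i
    by (simp add: sum_diff1 diag)
  moreover have "(if 0 < x i then mu i * (p0 P i + (\<Sum>j\<in>UNIV. P$i$j)) else 0)
     = (\<Sum>l\<in>UNIV. if 0 < x i then jackson_rates lam mu P (Some i) l else 0)" for i
    by (simp add: sum_option_UNIV sum_distrib_left algebra_simps cong: if_cong)
  ultimately have "outrate lam mu P x
      = (\<Sum>i\<in>UNIV. lam i) + (\<Sum>i\<in>UNIV. \<Sum>l\<in>UNIV. if 0 < x i then jackson_rates lam mu P (Some i) l else 0)"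
    unfolding outrate_def by (simp only: sum.distrib)
  then show ?thesis
    by (simp add: sum_option_UNIV[where f="\<lambda>k. \<Sum>l\<in>UNIV. if enabled k x then jackson_rates lam mu P k l else 0"])
      (simp add: sum_option_UNIV)
qed

text \<open>The uniformized kernel is the identity plus the generator divided by
  \<open>unif_const\<close>. Testing it on a finitely supported \<open>f\<close> avoids any question
  of summability.\<close>

lemma unif_kernel_sum:
  fixes f :: "('d::finite \<Rightarrow> nat) \<Rightarrow> real"
  assumes S: "finite S" "\<And>z. z \<notin> S \<Longrightarrow> f z = 0" and diag: "\<And>i. P$i$i = 0"
  shows "(\<Sum>z\<in>S. unif_kernel lam mu P x z * f z) = f x + gen (jackson_rates lam mu P) f x / unif_const lam mu"
proof -
  have js: "(\<Sum>z\<in>S. jrate lam mu P x z * f z)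
    = (\<Sum>k\<in>UNIV. \<Sum>l\<in>UNIV. if enabled k x then jackson_rates lam mu P k l * f (move k l x) else 0)"
    by (rule jrate_sum) (use S diag in auto)
  have "(\<Sum>z\<in>S. (if z = x then c else 0) * f z) = c * f x" for c
    using sum_if_eq_finite_support[where b=True, OF S] by simp
  then have "(\<Sum>z\<in>S. unif_kernel lam mu P x z * f z) = (\<Sum>z\<in>S. jrate lam mu P x z * f z) / unif_const lam mu
      + (1 - outrate lam mu P x / unif_const lam mu) * f x"
    unfolding unif_kernel_def by (simp add: distrib_right sum.distrib sum_divide_distrib)
  also have "\<dots> = f x + ((\<Sum>z\<in>S. jrate lam mu P x z * f z) - outrate lam mu P x * f x) / unif_const lam mu"
    by (simp add: algebra_simps diff_divide_distrib)
  also have "(\<Sum>z\<in>S. jrate lam mu P x z * f z) - outrate lam mu P x * f x = gen (jackson_rates lam mu P) f x"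
    unfolding gen_def js outrate_eq[OF diag] sum_distrib_right sum_subtractf[symmetric]
    by (intro sum.cong refl) (auto simp: algebra_simps)
  finally show ?thesis .
qed

lemma jrate_nonneg:
  assumes "\<And>i. 0 \<le> lam i" "\<And>i. 0 \<le> mu i" "\<And>i j. 0 \<le> P$i$j" "\<And>i. 0 \<le> p0 P i"
  shows "0 \<le> jrate lam mu P x y"
  unfolding jrate_def by (intro sum_nonneg add_nonneg_nonneg) (auto simp: assms)

lemma p0_sum_off_diag:
  assumes "P$i$i = 0"
  shows "p0 P i + (\<Sum>j\<in>UNIV - {i}. P$i$j) = 1"
  using assms by (simp add: p0_def sum_diff1)

lemma outrate_le:
  fixes lam mu :: "'d::finite \<Rightarrow> real"
  assumes "\<And>i. 0 \<le> lam i" "\<And>i. 0 \<le> mu i" "\<And>i. P$i$i = 0"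
  shows "outrate lam mu P x \<le> unif_const lam mu"
proof -
  have eq: "outrate lam mu P x = (\<Sum>i\<in>UNIV. lam i) + (\<Sum>i\<in>UNIV. if 0 < x i then mu i else 0)"
    unfolding outrate_def using p0_sum_off_diag[OF assms(3)] by (simp add: sum.distrib cong: if_cong)
  have "(\<Sum>i\<in>UNIV. if 0 < x i then mu i else 0) \<le> (\<Sum>i\<in>UNIV. mu i)"
    by (intro sum_mono) (auto simp: assms)
  then show "outrate lam mu P x \<le> unif_const lam mu"
    unfolding eq unif_const_def by simp
qed

lemma unif_const_pos:
  assumes "\<And>i. 0 \<le> lam i" "\<And>i. 0 \<le> mu i"
  shows "0 < unif_const lam mu"
  unfolding unif_const_def using sum_nonneg[of UNIV lam] sum_nonneg[of UNIV mu] assms by simp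

lemma unif_kernel_nonneg:
  assumes "\<And>i. 0 \<le> lam i" "\<And>i. 0 \<le> mu i" "\<And>i j. 0 \<le> P$i$j" "\<And>i. 0 \<le> p0 P i" "\<And>i. P$i$i = 0"
  shows "0 \<le> unif_kernel lam mu P x y"
proof -
  have "outrate lam mu P x / unif_const lam mu \<le> 1"
    using outrate_le[of lam mu P x] unif_const_pos[of lam mu] assms by simp
  then show ?thesis
    unfolding unif_kernel_def
    using jrate_nonneg[of lam mu P x y] unif_const_pos[of lam mu] assms by simp
qed

text \<open>The generator annihilates constants. This is applied to the indicator of a finite set
  \<open>T\<close> that contains \<open>x\<close> and the results of all moves from
  \<open>x\<close>, since row \<open>x\<close> of the kernel vanishes off \<open>T\<close>.\<close>

lemma nn_integral_unif_kernel_le: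
  fixes lam mu :: "'d::finite \<Rightarrow> real"
  assumes "\<And>i. 0 \<le> lam i" "\<And>i. 0 \<le> mu i" "\<And>i j. 0 \<le> P$i$j" "\<And>i. 0 \<le> p0 P i" "\<And>i. P$i$i = 0"
  shows "(\<integral>\<^sup>+z. ennreal (unif_kernel lam mu P x z) \<partial>count_space UNIV) \<le> 1"
proof -
  define T where "T = (\<Union>k l. {move k l x}) \<union> {x}"
  have finT: "finite T" unfolding T_def by auto
  have mem: "move k l x \<in> T" for k l unfolding T_def by auto
  have fu: "x(i := x i + 1) \<in> T" "0 < x i \<Longrightarrow> x(i := x i - 1) \<in> T" for i
    using mem[of None "Some i"] mem[of "Some i" None] by (simp_all add: move_def)
  have fu2: "x(i := x i - 1, j := x j + 1) \<in> T" if "j \<noteq> i" for i j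
    using mem[of "Some i" "Some j"] that by (simp add: move_def)
  have outside: "unif_kernel lam mu P x z = 0" if "z \<notin> T" for z
  proof -
    have "z \<noteq> x" using that by (auto simp: T_def)
    moreover have "z \<noteq> x(i := x i + 1)" "\<not> (0 < x i \<and> z = x(i := x i - 1))"
      "\<not> (j \<noteq> i \<and> 0 < x i \<and> z = x(i := x i - 1, j := x j + 1))" for i j
      using that fu fu2 by blast+
    then have "jrate lam mu P x z = 0"
      unfolding jrate_def by (simp only: if_False sum.neutral_const add_0_right)
    ultimately show ?thesis by (simp add: unif_kernel_def)
  qed
  let ?f = "\<lambda>z. if z \<in> T then 1 else (0::real)"
  have "(\<Sum>z\<in>T. unif_kernel lam mu P x z * ?f z)
      = ?f x + gen (jackson_rates lam mu P) ?f x / unif_const lam mu"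
    by (rule unif_kernel_sum) (use finT assms in auto)
  moreover have "gen (jackson_rates lam mu P) ?f x = 0"
    unfolding gen_def using mem by (intro sum.neutral ballI) (auto simp: T_def)
  ultimately have 1: "(\<Sum>z\<in>T. unif_kernel lam mu P x z) = 1"
    by (simp add: T_def)
  have "(\<integral>\<^sup>+z. ennreal (unif_kernel lam mu P x z) \<partial>count_space UNIV) = (\<Sum>z\<in>T. ennreal (unif_kernel lam mu P x z))"
    by (rule nn_integral_count_space') (use finT outside in auto)
  also have "\<dots> = ennreal (\<Sum>z\<in>T. unif_kernel lam mu P x z)"
    by (intro sum_ennreal unif_kernel_nonneg) (use assms in auto)
  finally show ?thesis using 1 by simp
qed

section \<open>Bounds on the taboo transition function\<close>

lemma taboo_steps_le_1:
  fixes lam mu :: "'d::finite \<Rightarrow> real"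
  assumes "\<And>i. 0 \<le> lam i" "\<And>i. 0 \<le> mu i" "\<And>i j. 0 \<le> P$i$j" "\<And>i. 0 \<le> p0 P i" "\<And>i. P$i$i = 0"
  shows "taboo_steps lam mu P E n x y \<le> 1"
proof (induction n arbitrary: x)
  case (Suc n)
  have "taboo_steps lam mu P E (Suc n) x y \<le> (\<integral>\<^sup>+z. ennreal (unif_kernel lam mu P x z) \<partial>count_space UNIV)"
    unfolding taboo_steps.simps
  proof (rule nn_integral_mono)
    fix z
    have "ennreal (unif_kernel lam mu P x z) * indicator (- E) z * taboo_steps lam mu P E n z y
       \<le> ennreal (unif_kernel lam mu P x z) * 1 * 1"
      by (intro mult_mono Suc.IH) (auto simp: indicator_def)
    then show "ennreal (unif_kernel lam mu P x z) * indicator (- E) z * taboo_steps lam mu P E n z y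
       \<le> ennreal (unif_kernel lam mu P x z)" by simp
  qed
  also have "\<dots> \<le> 1" by (rule nn_integral_unif_kernel_le) (use assms in auto)
  finally show ?case .
qed simp

text \<open>This is the generating function of the Poisson law with mean \<open>u * t\<close>,
  evaluated at \<open>v\<close>.\<close>

lemma suminf_ennreal_poisson:
  fixes u v t :: real
  assumes "0 \<le> u" "0 \<le> v" "0 \<le> t"
  shows "(\<Sum>n. ennreal (exp (- u * t) * (u * t) ^ n / fact n) * ennreal (v ^ n)) = ennreal (exp (u * (v - 1) * t))"
proof -
  have s: "(\<lambda>n. (u * t * v) ^ n /\<^sub>R fact n) sums exp (u * t * v)"
    by (rule exp_converges)
  have "(\<lambda>n. exp (- u * t) * ((u * t * v) ^ n /\<^sub>R fact n)) sums (exp (- u * t) * exp (u * t * v))"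
    by (rule sums_mult[OF s])
  then have "(\<lambda>n. exp (- u * t) * (u * t) ^ n / fact n * v ^ n) sums exp (u * (v - 1) * t)"
    by (simp add: exp_add[symmetric] algebra_simps power_mult_distrib divide_inverse)
  moreover have "ennreal (exp (- u * t) * (u * t) ^ n / fact n) * ennreal (v ^ n)
      = ennreal (exp (- u * t) * (u * t) ^ n / fact n * v ^ n)" for n
    using assms by (intro ennreal_mult[symmetric]) auto
  ultimately show ?thesis
    using assms by (simp only: suminf_ennreal_eq) (intro suminf_ennreal_eq, auto)
qed

lemma taboo_prob_le_1:
  fixes lam mu :: "'d::finite \<Rightarrow> real"
  assumes "\<And>i. 0 \<le> lam i" "\<And>i. 0 \<le> mu i" "\<And>i j. 0 \<le> P$i$j" "\<And>i. 0 \<le> p0 P i" "\<And>i. P$i$i = 0"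
    and t: "0 \<le> t"
  shows "taboo_prob lam mu P E t x y \<le> 1"
proof -
  let ?u = "unif_const lam mu"
  have "taboo_prob lam mu P E t x y \<le> (\<Sum>n. ennreal (exp (- ?u * t) * (?u * t) ^ n / fact n) * ennreal (1 ^ n))"
    unfolding taboo_prob_def
    by (intro suminf_le mult_left_mono) (use taboo_steps_le_1[of lam mu P E _ x y] assms in auto)
  also have "\<dots> = ennreal (exp (?u * (1 - 1) * t))"
    by (rule suminf_ennreal_poisson) (use unif_const_pos[of lam mu] assms in auto)
  finally show ?thesis by simp
qed

text \<open>One step of the kernel multiplies \<open>f\<close> by at least
  \<open>1 - s / unif_const lam mu\<close>. The bound on \<open>s\<close> makes this factor
  nonnegative, so the inequality iterates. Because \<open>f\<close> vanishes on \<open>E\<close>,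
  forbidding \<open>E\<close> loses nothing.\<close>

lemma taboo_steps_sum_ge:
  fixes lam mu :: "'d::finite \<Rightarrow> real"
  assumes rates: "\<And>i. 0 \<le> lam i" "\<And>i. 0 \<le> mu i" "\<And>i j. 0 \<le> P$i$j" "\<And>i. 0 \<le> p0 P i" "\<And>i. P$i$i = 0"
    and S: "finite S" "\<And>z. z \<notin> S \<Longrightarrow> f z = 0" "\<And>z. 0 \<le> f z" "\<And>z. z \<in> E \<Longrightarrow> f z = 0"
    and sub: "\<And>x. - s * f x \<le> gen (jackson_rates lam mu P) f x"
    and s: "s \<le> unif_const lam mu"
  shows "ennreal ((1 - s / unif_const lam mu) ^ n) * ennreal (f x)
      \<le> (\<Sum>y\<in>S. taboo_steps lam mu P E n x y * ennreal (f y))"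
proof (induction n arbitrary: x)
  case 0
  have "(\<Sum>y\<in>S. taboo_steps lam mu P E 0 x y * ennreal (f y)) = (\<Sum>y\<in>S. if x = y then ennreal (f y) else 0)"
    by (intro sum.cong) auto
  also have "\<dots> = ennreal (f x)"
    using S(1,2) by (cases "x \<in> S") (auto simp: sum.delta)
  finally show ?case by simp
next
  case (Suc n)
  let ?u = "unif_const lam mu"
  let ?K = "unif_kernel lam mu P"
  define c where "c = 1 - s / ?u"
  have u: "0 < ?u" by (rule unif_const_pos) (use rates in auto)
  have c: "0 \<le> c" using s u unfolding c_def by simp
  have K: "0 \<le> ?K x z" for z by (rule unif_kernel_nonneg) (use rates in auto)
  have "c * f x = f x + (- s * f x) / ?u" unfolding c_def by (simp add: algebra_simps)
  also have "\<dots> \<le> f x + gen (jackson_rates lam mu P) f x / ?u"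
    using sub[of x] u by (intro add_left_mono divide_right_mono) auto
  also have "\<dots> = (\<Sum>z\<in>S. ?K x z * f z)"
    by (rule unif_kernel_sum[symmetric]) (use S rates in auto)
  finally have 1: "c * f x \<le> (\<Sum>z\<in>S. ?K x z * f z)" .
  have "ennreal (c ^ Suc n) * ennreal (f x) = ennreal (c ^ n * (c * f x))"
    using c S(3)[of x] by (simp add: ennreal_mult[symmetric] algebra_simps)
  also have "\<dots> \<le> ennreal (c ^ n * (\<Sum>z\<in>S. ?K x z * f z))"
    using 1 c by (intro ennreal_leI mult_left_mono) auto
  also have "\<dots> = (\<Sum>z\<in>S. ennreal (?K x z) * (ennreal (c ^ n) * ennreal (f z)))"
  proof -
    have "ennreal (?K x z) * (ennreal (c ^ n) * ennreal (f z)) = ennreal (c ^ n * (?K x z * f z))" for z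
      using c K[of z] S(3)[of z] by (simp add: ennreal_mult[symmetric] algebra_simps)
    then show ?thesis using c K S(3) by (simp add: sum_distrib_left)
  qed
  also have "\<dots> = (\<Sum>z\<in>S. ennreal (?K x z) * indicator (- E) z * (ennreal (c ^ n) * ennreal (f z)))"
    using S(4) by (intro sum.cong refl) (auto simp: indicator_def)
  also have "\<dots> = (\<integral>\<^sup>+z. ennreal (?K x z) * indicator (- E) z * (ennreal (c ^ n) * ennreal (f z)) \<partial>count_space UNIV)"
    by (rule nn_integral_count_space'[symmetric]) (use S in auto)
  also have "\<dots> \<le> (\<integral>\<^sup>+z. ennreal (?K x z) * indicator (- E) z
       * (\<Sum>y\<in>S. taboo_steps lam mu P E n z y * ennreal (f y)) \<partial>count_space UNIV)"
    using Suc.IH unfolding c_def by (intro nn_integral_mono mult_left_mono) auto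
  also have "\<dots> = (\<Sum>y\<in>S. \<integral>\<^sup>+z. ennreal (?K x z) * indicator (- E) z
       * taboo_steps lam mu P E n z y * ennreal (f y) \<partial>count_space UNIV)"
    by (subst nn_integral_sum[symmetric]) (auto simp: sum_distrib_left mult.assoc)
  also have "\<dots> = (\<Sum>y\<in>S. taboo_steps lam mu P E (Suc n) x y * ennreal (f y))"
    by (simp add: nn_integral_multc)
  finally show ?case unfolding c_def .
qed

text \<open>Averaging the discrete bound over the Poisson number of steps turns the powers of
  \<open>1 - s / unif_const lam mu\<close> into \<open>exp (- s * t)\<close>.\<close>

lemma taboo_prob_sum_ge:
  fixes lam mu :: "'d::finite \<Rightarrow> real"
  assumes rates: "\<And>i. 0 \<le> lam i" "\<And>i. 0 \<le> mu i" "\<And>i j. 0 \<le> P$i$j" "\<And>i. 0 \<le> p0 P i" "\<And>i. P$i$i = 0"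
    and S: "finite S" "\<And>z. z \<notin> S \<Longrightarrow> f z = 0" "\<And>z. 0 \<le> f z" "\<And>z. z \<in> E \<Longrightarrow> f z = 0"
    and sub: "\<And>x. - s * f x \<le> gen (jackson_rates lam mu P) f x"
    and s: "s \<le> unif_const lam mu" and t: "0 \<le> t"
  shows "ennreal (exp (- s * t)) * ennreal (f x) \<le> (\<Sum>y\<in>S. taboo_prob lam mu P E t x y * ennreal (f y))"
proof -
  let ?u = "unif_const lam mu"
  let ?p = "\<lambda>n. ennreal (exp (- ?u * t) * (?u * t) ^ n / fact n)"
  have u: "0 < ?u" by (rule unif_const_pos) (use rates in auto)
  have "ennreal (exp (?u * ((1 - s / ?u) - 1) * t)) = (\<Sum>n. ?p n * ennreal ((1 - s / ?u) ^ n))"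
    by (rule suminf_ennreal_poisson[symmetric]) (use u s t in auto)
  moreover have "?u * ((1 - s / ?u) - 1) * t = - s * t" using u by simp
  ultimately have "ennreal (exp (- s * t)) * ennreal (f x) = (\<Sum>n. ?p n * ennreal ((1 - s / ?u) ^ n)) * ennreal (f x)"
    by metis
  also have "\<dots> = (\<Sum>n. ?p n * (ennreal ((1 - s / ?u) ^ n) * ennreal (f x)))"
    by (subst ennreal_suminf_multc[symmetric]) (simp only: mult.assoc)
  also have "\<dots> \<le> (\<Sum>n. ?p n * (\<Sum>y\<in>S. taboo_steps lam mu P E n x y * ennreal (f y)))"
    by (intro suminf_le mult_left_mono taboo_steps_sum_ge) (use assms in auto)
  also have "\<dots> = (\<Sum>n. \<Sum>y\<in>S. ?p n * taboo_steps lam mu P E n x y * ennreal (f y))"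
    by (simp add: sum_distrib_left mult.assoc)
  also have "\<dots> = (\<Sum>y\<in>S. \<Sum>n. ?p n * taboo_steps lam mu P E n x y * ennreal (f y))"
    by (rule suminf_sum) auto
  also have "\<dots> = (\<Sum>y\<in>S. taboo_prob lam mu P E t x y * ennreal (f y))"
    unfolding taboo_prob_def by simp
  finally show ?thesis .
qed

section \<open>From test functions to the essential spectral radius\<close>

lemma borel_measurable_taboo_prob [measurable]:
  "(\<lambda>t. taboo_prob lam mu P E t x y) \<in> borel_measurable borel"
  unfolding taboo_prob_def by measurable

text \<open>Taboo probabilities are at most 1, so \<open>r = exp 1\<close> always qualifies. Hence
  the set whose infimum is the radius is nonempty, as \<open>cInf_greatest\<close> demands.\<close>

lemma nn_integral_taboo_prob_less_top:
  fixes lam mu :: "'d::finite \<Rightarrow> real"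
  assumes rates: "\<And>i. 0 \<le> lam i" "\<And>i. 0 \<le> mu i" "\<And>i j. 0 \<le> P$i$j" "\<And>i. 0 \<le> p0 P i" "\<And>i. P$i$i = 0"
  shows "(\<integral>\<^sup>+ t. indicator {0..} t * ennreal (exp 1 powr (- t)) * taboo_prob lam mu P E t x y \<partial>lborel) < \<infinity>"
proof -
  have "(\<integral>\<^sup>+ t. indicator {0..} t * ennreal (exp 1 powr (- t)) * taboo_prob lam mu P E t x y \<partial>lborel)
      \<le> (\<integral>\<^sup>+ t. ennreal (exp (- t)) * indicator {0..} t \<partial>lborel)"
  proof (rule nn_integral_mono)
    fix t :: real
    show "indicator {0..} t * ennreal (exp 1 powr (- t)) * taboo_prob lam mu P E t x y
        \<le> ennreal (exp (- t)) * indicator {0..} t"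
    proof (cases "0 \<le> t")
      case True
      have "taboo_prob lam mu P E t x y \<le> 1"
        by (rule taboo_prob_le_1) (use rates True in auto)
      then have "ennreal (exp (- t)) * taboo_prob lam mu P E t x y \<le> ennreal (exp (- t)) * 1"
        by (intro mult_left_mono) auto
      then show ?thesis using True by (simp add: powr_def)
    qed simp
  qed
  also have "\<dots> = ennreal (0 - (- exp (- 0)))"
  proof (rule nn_integral_FTC_atLeast[where F="\<lambda>t. - exp (- t)"])
    show "((\<lambda>t::real. - exp (- t)) \<longlongrightarrow> 0) at_top"
      using tendsto_minus[OF filterlim_compose[OF exp_at_bot filterlim_uminus_at_bot_at_top]] by simp
  qed (auto intro!: derivative_eq_intros)
  finally show ?thesis
    by (rule le_less_trans) (simp add: ennreal_less_top)
qed

text \<open>If \<open>r < exp (- s)\<close>, the weight \<open>r powr (- t)\<close> outgrows the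
  decay of the semigroup on \<open>f\<close>, so a finite combination of the defining integrals
  dominates the integral of a positive constant over the half-line. A test function is required for
  every finite \<open>E\<close> because the infimum ranges over all of them.\<close>

lemma exp_le_ess_spec_radius:
  fixes lam mu :: "'d::finite \<Rightarrow> real"
  assumes rates: "\<And>i. 0 \<le> lam i" "\<And>i. 0 \<le> mu i" "\<And>i j. 0 \<le> P$i$j" "\<And>i. 0 \<le> p0 P i" "\<And>i. P$i$i = 0"
    and s: "s \<le> unif_const lam mu"
    and test: "\<And>E. finite E \<Longrightarrow> \<exists>f. finite {z. f z \<noteq> 0} \<and> (\<forall>z. 0 \<le> f z) \<and> (\<forall>z\<in>E. f z = 0) \<and> (\<exists>z. f z \<noteq> 0)
        \<and> (\<forall>x. - s * f x \<le> gen (jackson_rates lam mu P) f x)"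
  shows "exp (- s) \<le> ess_spec_radius lam mu P"
  unfolding ess_spec_radius_def
proof (rule cInf_greatest)
  show "{r::real. 0 < r \<and> (\<exists>E. finite E \<and> (\<forall>x y. x \<notin> E \<longrightarrow> y \<notin> E \<longrightarrow>
             (\<integral>\<^sup>+ t. indicator {0..} t * ennreal (r powr (- t)) * taboo_prob lam mu P E t x y
                \<partial>lborel) < \<infinity>))} \<noteq> {}"
    using nn_integral_taboo_prob_less_top[of lam mu P "{}"] rates
    by (auto intro!: exI[of _ "exp 1"] exI[of _ "{}"])
next
  fix r :: real
  assume "r \<in> {r::real. 0 < r \<and> (\<exists>E. finite E \<and> (\<forall>x y. x \<notin> E \<longrightarrow> y \<notin> E \<longrightarrow>
             (\<integral>\<^sup>+ t. indicator {0..} t * ennreal (r powr (- t)) * taboo_prob lam mu P E t x y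
                \<partial>lborel) < \<infinity>))}"
  then obtain E where r: "0 < r" and E: "finite E"
    and int: "\<And>x y. x \<notin> E \<Longrightarrow> y \<notin> E \<Longrightarrow>
      (\<integral>\<^sup>+ t. indicator {0..} t * ennreal (r powr (- t)) * taboo_prob lam mu P E t x y \<partial>lborel) < \<infinity>"
    by blast
  obtain f x where f: "finite {z. f z \<noteq> 0}" "\<And>z. 0 \<le> f z" "\<And>z. z \<in> E \<Longrightarrow> f z = 0" "f x \<noteq> 0"
    and sub: "\<And>x. - s * f x \<le> gen (jackson_rates lam mu P) f x"
    using test[OF E] by blast
  let ?S = "{z. f z \<noteq> 0}"
  let ?g = "\<lambda>y t. indicator {0..} t * ennreal (r powr (- t)) * taboo_prob lam mu P E t x y"
  show "exp (- s) \<le> r"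
  proof (rule ccontr)
    assume "\<not> exp (- s) \<le> r"
    then have lr: "ln r < - s" using ln_less_cancel_iff[of r "exp (- s)"] r by simp
    have ge: "ennreal (f x) * indicator {0..} t \<le> (\<Sum>y\<in>?S. ?g y t * ennreal (f y))" for t
    proof (cases "0 \<le> t")
      case True
      have "1 \<le> exp (- s * t - ln r * t)"
        using lr True mult_right_mono[of "ln r" "- s" t] by simp
      then have "ennreal (f x) \<le> ennreal (exp (- s * t - ln r * t) * f x)"
        using f(2)[of x] by (intro ennreal_leI) (simp add: mult_le_cancel_right1)
      also have "exp (- s * t - ln r * t) = r powr (- t) * exp (- s * t)"
        using r by (simp add: powr_def exp_add[symmetric] algebra_simps)
      also have "ennreal (r powr (- t) * exp (- s * t) * f x)
          = ennreal (r powr (- t)) * (ennreal (exp (- s * t)) * ennreal (f x))"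
        using f(2)[of x] by (simp add: ennreal_mult mult.assoc)
      also have "\<dots> \<le> ennreal (r powr (- t)) * (\<Sum>y\<in>?S. taboo_prob lam mu P E t x y * ennreal (f y))"
        by (intro mult_left_mono taboo_prob_sum_ge) (use rates f sub s True in auto)
      also have "\<dots> = (\<Sum>y\<in>?S. ?g y t * ennreal (f y))"
        using True by (simp add: sum_distrib_left mult.assoc)
      finally show ?thesis using True by simp
    qed simp
    have "(\<integral>\<^sup>+t. ennreal (f x) * indicator {0::real..} t \<partial>lborel) = \<infinity>"
    proof -
      have "(\<integral>\<^sup>+t. ennreal (f x) * indicator {0::real..} t \<partial>lborel) = ennreal (f x) * emeasure lborel {0::real..}"
        by (simp add: nn_integral_cmult_indicator)
      moreover have "of_nat n \<le> emeasure lborel {0::real..}" for n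
        using emeasure_mono[of "{0..real n}" "{0::real..}" lborel] by (simp add: ennreal_of_nat_eq_real_of_nat)
      then have "emeasure lborel {0::real..} = \<infinity>"
        using SUP_least[of UNIV "\<lambda>n. of_nat n :: ennreal" "emeasure lborel {0::real..}"]
        by (simp add: ennreal_SUP_of_nat_eq_top top.extremum_unique)
      ultimately show ?thesis
        using f(2)[of x] f(4) by (simp add: ennreal_mult_top)
    qed
    moreover have "(\<integral>\<^sup>+t. ennreal (f x) * indicator {0::real..} t \<partial>lborel) \<le> (\<integral>\<^sup>+t. (\<Sum>y\<in>?S. ?g y t * ennreal (f y)) \<partial>lborel)"
      by (intro nn_integral_mono ge)
    moreover have "\<dots> = (\<Sum>y\<in>?S. (\<integral>\<^sup>+t. ?g y t \<partial>lborel) * ennreal (f y))"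
      by (subst nn_integral_sum) (auto simp: nn_integral_multc)
    moreover have "\<dots> < \<infinity>"
    proof -
      \<comment> \<open>Both \<open>x\<close> and \<open>y\<close> lie in the support of
        \<open>f\<close>, hence off \<open>E\<close>, where finiteness is known.\<close>
      have "(\<integral>\<^sup>+t. ?g y t \<partial>lborel) * ennreal (f y) < \<infinity>" if "y \<in> ?S" for y
        using int[of x y] f(3,4) that by (auto intro!: ennreal_mult_less_top[THEN iffD2])
      then show ?thesis using f(1) by (simp add: less_top)
    qed
    ultimately show False by simp
  qed
qed

section \<open>A test function from a martingale and a Lyapunov function\<close>

definition wt :: "('d \<Rightarrow> real) \<Rightarrow> 'd option \<Rightarrow> real" where
  "wt c k = (case k of None \<Rightarrow> 0 | Some a \<Rightarrow> c a)"

lemma wt_simps [simp]: "wt c None = 0" "wt c (Some a) = c a"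
  by (simp_all add: wt_def)

definition lin :: "('d::finite \<Rightarrow> real) \<Rightarrow> ('d \<Rightarrow> nat) \<Rightarrow> real" where
  "lin c x = (\<Sum>a\<in>UNIV. c a * real (x a))"

lemma lin_fun_upd: "lin c (x(a := n)) = lin c x + c a * (real n - real (x a))"
proof -
  have "lin c (x(a := n)) = c a * real n + (\<Sum>b\<in>UNIV - {a}. c b * real (x b))"
    unfolding lin_def by (subst sum.remove[of _ a]) auto
  moreover have "lin c x = c a * real (x a) + (\<Sum>b\<in>UNIV - {a}. c b * real (x b))"
    unfolding lin_def by (subst sum.remove[of _ a]) auto
  ultimately show ?thesis by (simp add: algebra_simps)
qed

lemma lin_move:
  assumes "enabled k x"
  shows "lin c (move k l x) = lin c x + (wt c l - wt c k)"
  using assms by (cases k; cases l) (auto simp: move_def lin_fun_upd Let_def of_nat_diff algebra_simps)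

text \<open>By \<open>lin_move\<close>, this is the generator applied to
  \<open>lin c\<close>.\<close>

definition drift :: "('d::finite option \<Rightarrow> 'd option \<Rightarrow> real) \<Rightarrow> ('d \<Rightarrow> real) \<Rightarrow> ('d \<Rightarrow> nat) \<Rightarrow> real" where
  "drift q c x = (\<Sum>k\<in>UNIV. \<Sum>l\<in>UNIV. if enabled k x then q k l * (wt c l - wt c k) else 0)"

text \<open>The infinitesimal quadratic variation of \<open>lin c\<close> along the process.\<close>

definition qvar :: "('d::finite option \<Rightarrow> 'd option \<Rightarrow> real) \<Rightarrow> ('d \<Rightarrow> real) \<Rightarrow> ('d \<Rightarrow> nat) \<Rightarrow> real" where
  "qvar q c x = (\<Sum>k\<in>UNIV. \<Sum>l\<in>UNIV. if enabled k x then q k l * (wt c l - wt c k)\<^sup>2 else 0)"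

text \<open>Only increments at \<open>x\<close> are compared. So the lemma applies whenever
  \<open>g\<close> dominates \<open>f\<close> and agrees with it at \<open>x\<close>, for instance
  after truncation from below.\<close>

lemma gen_mono_at:
  assumes "\<And>k l. 0 \<le> q k l"
    and "\<And>k l. enabled k x \<Longrightarrow> f (move k l x) - f x \<le> g (move k l x) - g x"
  shows "gen q f x \<le> gen q g x"
  unfolding gen_def by (intro sum_mono) (auto intro!: mult_left_mono assms)

lemma gen_diff_scaled: "gen q (\<lambda>z. f z - d * g z) x = gen q f x - d * gen q g x"
  unfolding gen_def sum_distrib_left sum_subtractf[symmetric]
  by (intro sum.cong refl) (auto simp: algebra_simps)

lemma gen_sum: "gen q (\<lambda>z. \<Sum>j\<in>J. f j z) x = (\<Sum>j\<in>J. gen q (f j) x)"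
proof -
  have "(\<Sum>j\<in>J. gen q (f j) x)
      = (\<Sum>k\<in>UNIV. \<Sum>l\<in>UNIV. \<Sum>j\<in>J. if enabled k x then q k l * (f j (move k l x) - f j x) else 0)"
    unfolding gen_def by (subst sum.swap, intro sum.cong refl, rule sum.swap)
  also have "\<dots> = gen q (\<lambda>z. \<Sum>j\<in>J. f j z) x"
    unfolding gen_def by (intro sum.cong refl) (auto simp: sum_distrib_left sum_subtractf right_diff_distrib)
  finally show ?thesis by simp
qed

text \<open>A second-order Taylor bound valid for every enabled move integrates to a bound in terms
  of drift and quadratic variation.\<close>

lemma gen_ge_of_quadratic:
  assumes q: "\<And>k l. 0 \<le> q k l"
    and "\<And>k l. enabled k x \<Longrightarrow>
      A * (wt c l - wt c k) + B * (wt c l - wt c k)\<^sup>2 \<le> f (move k l x) - f x"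
  shows "A * drift q c x + B * qvar q c x \<le> gen q f x"
proof -
  have "A * drift q c x + B * qvar q c x = (\<Sum>k\<in>UNIV. \<Sum>l\<in>UNIV. if enabled k x then
      q k l * (A * (wt c l - wt c k) + B * (wt c l - wt c k)\<^sup>2) else 0)"
    unfolding drift_def qvar_def sum_distrib_left sum.distrib[symmetric]
    by (intro sum.cong refl) (auto simp: algebra_simps)
  also have "\<dots> \<le> gen q f x"
    unfolding gen_def by (intro sum_mono) (auto intro!: mult_left_mono assms)
  finally show ?thesis .
qed

lemma gen_le_of_quadratic:
  assumes q: "\<And>k l. 0 \<le> q k l"
    and "\<And>k l. enabled k x \<Longrightarrow>
      f (move k l x) - f x \<le> A * (wt c l - wt c k) + B * (wt c l - wt c k)\<^sup>2"
  shows "gen q f x \<le> A * drift q c x + B * qvar q c x"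
proof -
  have "A * drift q c x + B * qvar q c x = (\<Sum>k\<in>UNIV. \<Sum>l\<in>UNIV. if enabled k x then
      q k l * (A * (wt c l - wt c k) + B * (wt c l - wt c k)\<^sup>2) else 0)"
    unfolding drift_def qvar_def sum_distrib_left sum.distrib[symmetric]
    by (intro sum.cong refl) (auto simp: algebra_simps)
  moreover have "gen q f x \<le> \<dots>"
    unfolding gen_def by (intro sum_mono) (auto intro!: mult_left_mono assms)
  ultimately show ?thesis by simp
qed

lemma qvar_le:
  assumes q: "\<And>k l. 0 \<le> q k l" and c: "\<And>k l. \<bar>wt c l - wt c k\<bar> \<le> M"
  shows "qvar q c x \<le> M\<^sup>2 * (\<Sum>k\<in>UNIV. \<Sum>l\<in>UNIV. q k l)"
  unfolding qvar_def sum_distrib_left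
proof (intro sum_mono)
  fix k l
  have "(wt c l - wt c k)\<^sup>2 \<le> M\<^sup>2" using c[of l k] by (simp add: abs_le_square_iff[symmetric])
  then show "(if enabled k x then q k l * (wt c l - wt c k)\<^sup>2 else 0) \<le> M\<^sup>2 * q k l"
    using q[of k l] by (auto simp: mult.commute mult_left_mono)
qed

text \<open>External arrivals are enabled in every state, so their share bounds the quadratic
  variation below uniformly in \<open>x\<close>.\<close>

lemma qvar_ge:
  assumes q: "\<And>k l. 0 \<le> q k l"
  shows "(\<Sum>l\<in>UNIV. q None l * (wt c l)\<^sup>2) \<le> qvar q c x"
  unfolding qvar_def sum_option_UNIV[where f="\<lambda>k. \<Sum>l\<in>UNIV. _ k l"]
  by (simp add: q sum_nonneg)

text \<open>Taylor expansion of \<open>(t\<^sup>2 - 1)\<^sup>2\<close>: the coefficients are the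
  first derivative and half the second. The remainder \<open>4 * t * h ^ 3 + h ^ 4\<close> is at
  least \<open>- 4 * \<theta> * h\<^sup>2\<close>.\<close>

lemma quartic_bump_increment:
  fixes t h \<theta> :: real
  assumes "\<bar>t\<bar> \<le> 1" "\<bar>h\<bar> \<le> \<theta>"
  shows "(4 * t ^ 3 - 4 * t) * h + (6 * t\<^sup>2 - 2 - 4 * \<theta>) * h\<^sup>2 \<le> ((t + h)\<^sup>2 - 1)\<^sup>2 - (t\<^sup>2 - 1)\<^sup>2"
proof -
  have "((t + h)\<^sup>2 - 1)\<^sup>2 - (t\<^sup>2 - 1)\<^sup>2 - ((4 * t ^ 3 - 4 * t) * h + (6 * t\<^sup>2 - 2 - 4 * \<theta>) * h\<^sup>2)
     = h\<^sup>2 * (4 * (\<theta> + t * h) + h\<^sup>2)"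
    by (simp add: power2_eq_square power3_eq_cube algebra_simps)
  moreover have "\<bar>t * h\<bar> \<le> 1 * \<theta>" unfolding abs_mult by (intro mult_mono assms) auto
  then have "0 \<le> \<theta> + t * h" by linarith
  then have "0 \<le> h\<^sup>2 * (4 * (\<theta> + t * h) + h\<^sup>2)" by simp
  ultimately show ?thesis by linarith
qed

lemma finite_bounded_states: "finite {x::'d::finite \<Rightarrow> nat. \<forall>a. real (x a) \<le> B}"
proof -
  have "{x::'d \<Rightarrow> nat. \<forall>a. real (x a) \<le> B} \<subseteq> PiE UNIV (\<lambda>_. {..nat \<lceil>B\<rceil>})"
    by (auto simp: PiE_def Pi_def) (metis ceiling_mono ceiling_of_nat nat_int nat_mono)
  then show ?thesis by (rule finite_subset) (auto intro: finite_PiE)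
qed

text \<open>The test function is a cut-off of \<open>(t\<^sup>2 - 1)\<^sup>2 - 1/8 - \<delta> W\<close>, with \<open>t\<close> the rescaled martingale. The bump
  \<open>(t\<^sup>2 - 1)\<^sup>2\<close> is convex near \<open>t = \<plusminus>1\<close>, which pays for the bounded positive drift of \<open>\<delta> W\<close> there, and the
  offset \<open>1/8\<close> makes the function negative around \<open>t = \<plusminus>1\<close>, so that cutting it off there only helps.\<close>
lemma gen_test_function:
  fixes q :: "'d::finite option \<Rightarrow> 'd option \<Rightarrow> real" and W :: "('d \<Rightarrow> nat) \<Rightarrow> real"
  assumes q: "\<And>k l. 0 \<le> q k l"
    and c: "\<And>a. 0 \<le> c a" "\<And>a. c a \<le> 1" "c i = 1"
    and martingale: "\<And>x. 0 < x i \<Longrightarrow> drift q c x = 0"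
    and moves: "0 < (\<Sum>l\<in>UNIV. q None l * (wt c l)\<^sup>2)"
    and W: "\<And>x. 0 \<le> W x" "\<And>n. W ((\<lambda>_. 0)(i := n)) \<le> W0"
    and W_bdd: "\<And>B. \<exists>Y. \<forall>x a. W x \<le> B \<longrightarrow> a \<noteq> i \<longrightarrow> real (x a) \<le> Y"
    and K: "0 < K" "0 < \<kappa>"
    and lyap: "\<And>x. 0 < x i \<Longrightarrow> gen q W x \<le> K - \<kappa> * W x"
    and eps: "0 < \<epsilon>"
  shows "\<exists>\<psi>. finite {x. \<psi> x \<noteq> 0} \<and> (\<forall>x. 0 \<le> \<psi> x) \<and> (\<exists>x. \<psi> x \<noteq> 0) \<and> (\<forall>x. \<psi> x \<noteq> 0 \<longrightarrow> N \<le> real (x i))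
    \<and> (\<forall>x. 0 < x i \<longrightarrow> \<psi> x \<noteq> 0 \<longrightarrow> - \<epsilon> * \<psi> x \<le> gen q \<psi> x)"
proof -
  define \<sigma> where "\<sigma> = (\<Sum>l\<in>UNIV. q None l * (wt c l)\<^sup>2)"
  define Q where "Q = (\<Sum>k\<in>UNIV. \<Sum>l\<in>UNIV. q k l)"
  have \<sigma>: "0 < \<sigma>" using moves by (simp add: \<sigma>_def)
  have Q: "0 \<le> Q" unfolding Q_def by (intro sum_nonneg q)
  have W0: "0 \<le> W0" using W(1) W(2) order_trans by blast
  \<comment> \<open>\<open>m\<close> becomes \<open>\<theta>\<^sup>2\<close>. The three bounds yield
    in turn \<open>\<theta> \<le> 1/8\<close>, the two inequalities \<open>small\<close>, and
    \<open>\<delta> * W0 \<le> 1/2\<close>.\<close>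
  define m where "m = min (min (1/64) (min \<kappa> \<epsilon> / (16 * (3 * Q + \<sigma> / 2)))) (K / (\<sigma> * (W0 + 1)))"
  have m: "0 < m" unfolding m_def using \<sigma> Q K eps W0 by (auto intro!: divide_pos_pos add_nonneg_pos mult_pos_pos)
  define \<theta> where "\<theta> = sqrt m"
  have \<theta>: "0 < \<theta>" "\<theta>\<^sup>2 = m" unfolding \<theta>_def using m by auto
  have "m \<le> 1/64" unfolding m_def by linarith
  then have "\<theta>\<^sup>2 \<le> (1/8)\<^sup>2" unfolding \<theta> by (simp add: power2_eq_square)
  then have \<theta>8: "\<theta> \<le> 1/8" by (rule power2_le_imp_le) simp
  have "m * (16 * (3 * Q + \<sigma> / 2)) \<le> min \<kappa> \<epsilon>"
    using Q \<sigma> unfolding m_def by (subst pos_le_divide_eq[symmetric]) auto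
  then have small: "3 * \<theta>\<^sup>2 * Q + \<theta>\<^sup>2 * \<sigma> / 2 \<le> \<kappa> / 16" "3 * \<theta>\<^sup>2 * Q + \<theta>\<^sup>2 * \<sigma> / 2 \<le> \<epsilon> / 16"
    unfolding \<theta> by (auto simp: algebra_simps)
  \<comment> \<open>With this choice the worst drift \<open>\<delta> * K\<close> of the Lyapunov
    term equals half of \<open>\<theta>\<^sup>2 * \<sigma>\<close>, which is exactly what convexity
    of the bump supplies when \<open>1/2 \<le> (t x)\<^sup>2\<close>.\<close>
  define \<delta> where "\<delta> = \<theta>\<^sup>2 * \<sigma> / (2 * K)"
  have \<delta>: "0 < \<delta>" "\<delta> * K = \<theta>\<^sup>2 * \<sigma> / 2" unfolding \<delta>_def using \<theta> \<sigma> K by auto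
  have "m * (\<sigma> * (W0 + 1)) \<le> K"
    using \<sigma> W0 unfolding m_def by (subst pos_le_divide_eq[symmetric]) auto
  then have "\<delta> * (W0 + 1) \<le> 1/2"
    unfolding \<delta>_def \<theta> using K by (simp add: pos_divide_le_eq algebra_simps)
  then have \<delta>W0: "\<delta> * W0 \<le> 1/2" using \<delta> by (simp add: algebra_simps)
  obtain Y where Y: "\<And>x a. W x \<le> 1 / \<delta> \<Longrightarrow> a \<noteq> i \<Longrightarrow> real (x a) \<le> Y" using W_bdd by blast
  \<comment> \<open>On the support \<open>lin c x\<close> exceeds \<open>x0 - 1 / \<theta>\<close>,
    and the queues other than \<open>i\<close> contribute at most
    \<open>CARD('d) * \<bar>Y\<bar>\<close>, so at least \<open>N\<close> customers remain at
    \<open>i\<close>.\<close>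
  obtain x0 :: nat where x0: "N + 1 / \<theta> + real CARD('d) * \<bar>Y\<bar> \<le> real x0" using real_arch_simple by blast
  define t where "t x = \<theta> * (lin c x - real x0)" for x
  define \<phi> where "\<phi> x = (((t x)\<^sup>2 - 1)\<^sup>2 - 1/8) - \<delta> * W x" for x
  define \<psi> where "\<psi> x = (if \<bar>t x\<bar> < 1 then max 0 (\<phi> x) else 0)" for x
  have lin_i: "lin c x = real (x i) + (\<Sum>a\<in>UNIV - {i}. c a * real (x a))" for x
    unfolding lin_def using c(3) by (subst sum.remove[of _ i]) auto
  have supp: "\<bar>t x\<bar> < 1 \<and> W x \<le> 1 / \<delta> \<and> 0 < \<phi> x \<and> \<psi> x = \<phi> x" if "\<psi> x \<noteq> 0" for x
  proof -
    have 1: "\<bar>t x\<bar> < 1" "0 < \<phi> x" using that unfolding \<psi>_def by (auto split: if_splits simp: max_def)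
    have "(t x)\<^sup>2 \<le> 1" using 1(1) by (simp add: abs_square_le_1)
    then have "((t x)\<^sup>2 - 1)\<^sup>2 \<le> 1" by (intro abs_square_le_1[THEN iffD2]) auto
    then have "\<delta> * W x \<le> 1" using 1(2) unfolding \<phi>_def by simp
    then show ?thesis using 1 \<delta> by (simp add: \<psi>_def field_simps)
  qed
  have supp_N: "N \<le> real (x i)" if "\<psi> x \<noteq> 0" for x
  proof -
    have "(\<Sum>a\<in>UNIV - {i}. c a * real (x a)) \<le> (\<Sum>a\<in>UNIV - {i}. \<bar>Y\<bar>)"
    proof (intro sum_mono)
      fix a assume "a \<in> UNIV - {i}"
      then have "real (x a) \<le> Y" using Y[of x a] supp[OF that] by auto
      moreover have "c a * real (x a) \<le> 1 * real (x a)" by (intro mult_right_mono c) auto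
      ultimately show "c a * real (x a) \<le> \<bar>Y\<bar>" by linarith
    qed
    also have "\<dots> = real (card (UNIV - {i})) * \<bar>Y\<bar>" by simp
    also have "\<dots> \<le> real CARD('d) * \<bar>Y\<bar>"
      by (intro mult_right_mono) (auto intro: card_mono)
    finally have "lin c x \<le> real (x i) + real CARD('d) * \<bar>Y\<bar>" unfolding lin_i by simp
    moreover have "- (1 / \<theta>) \<le> lin c x - real x0"
      using supp[OF that] \<theta> unfolding t_def by (auto simp: field_simps abs_less_iff)
    ultimately show ?thesis using x0 by linarith
  qed
  have fin: "finite {x. \<psi> x \<noteq> 0}"
  proof (rule finite_subset[OF _ finite_bounded_states])
    show "{x. \<psi> x \<noteq> 0} \<subseteq> {x. \<forall>a. real (x a) \<le> \<bar>Y\<bar> + real x0 + 1 / \<theta>}"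
    proof (intro subsetI CollectI allI)
      fix x a assume "x \<in> {x. \<psi> x \<noteq> 0}"
      then have s: "\<psi> x \<noteq> 0" by simp
      show "real (x a) \<le> \<bar>Y\<bar> + real x0 + 1 / \<theta>"
      proof (cases "a = i")
        case True
        have "lin c x - real x0 \<le> 1 / \<theta>"
          using supp[OF s] \<theta> unfolding t_def by (auto simp: field_simps abs_less_iff)
        moreover have "real (x i) \<le> lin c x" unfolding lin_i by (simp add: sum_nonneg c)
        ultimately show ?thesis unfolding True by linarith
      next
        case False
        then have "real (x a) \<le> Y" using Y[of x a] supp[OF s] by auto
        moreover have "0 \<le> 1 / \<theta>" using \<theta> by simp
        ultimately show ?thesis by linarith
      qed
    qed
  qed
  \<comment> \<open>With all customers at \<open>i\<close> and \<open>t = 0\<close>, the bump minus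
    its offset is 7/8 and the Lyapunov term is at most 1/2.\<close>
  have nz: "\<psi> ((\<lambda>_. 0)(i := x0)) \<noteq> 0"
  proof -
    have "t ((\<lambda>_. 0)(i := x0)) = 0" unfolding t_def lin_i by simp
    moreover have "\<delta> * W ((\<lambda>_. 0)(i := x0)) \<le> \<delta> * W0" using W(2) \<delta> by (intro mult_left_mono) auto
    ultimately show ?thesis using \<delta>W0 unfolding \<psi>_def \<phi>_def by simp
  qed
  have jump: "\<bar>wt c l - wt c k\<bar> \<le> 1" for k l
  proof -
    have "0 \<le> wt c k" "wt c k \<le> 1" for k using c by (cases k; simp)+
    then show ?thesis by (smt (verit))
  qed
  have t_move: "t (move k l x) = t x + \<theta> * (wt c l - wt c k)" if "enabled k x" for k l x
    using that unfolding t_def by (simp add: lin_move algebra_simps)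
  have h_le: "\<bar>\<theta> * (wt c l - wt c k)\<bar> \<le> \<theta>" for k l
    using jump[of l k] \<theta> by (simp add: abs_mult mult_left_le)
  have main: "- \<epsilon> * \<psi> x \<le> gen q \<psi> x" if xi: "0 < x i" and s: "\<psi> x \<noteq> 0" for x
  proof -
    have tx: "\<bar>t x\<bar> < 1" and \<phi>x: "0 < \<phi> x" "\<psi> x = \<phi> x" using supp[OF s] by auto
    have "gen q \<phi> x \<le> gen q \<psi> x"
    proof (rule gen_mono_at[OF q])
      fix k l assume en: "enabled k x"
      have "\<phi> (move k l x) \<le> \<psi> (move k l x)"
      proof (cases "\<bar>t (move k l x)\<bar> < 1")
        case True then show ?thesis by (simp add: \<psi>_def)
      next
        case False
        define u where "u = \<bar>t (move k l x)\<bar>"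
        \<comment> \<open>A move shifts \<open>t\<close> by at most
          \<open>\<theta> \<le> 1/8\<close>, so a jump out of the window lands where the bump is
          still below the offset 1/8 and \<open>\<phi>\<close> is nonpositive.\<close>
        have u: "1 \<le> u" "u \<le> 9/8"
          using False t_move[OF en, of l] h_le[of l k] tx \<theta>8 unfolding u_def by linarith+
        then have "u * u \<le> 9/8 * (9/8)" "1 * 1 \<le> u * u" by (intro mult_mono; simp)+
        then have "\<bar>u\<^sup>2 - 1\<bar> \<le> 17/64" by (simp add: power2_eq_square)
        then have "(u\<^sup>2 - 1)\<^sup>2 \<le> (17/64)\<^sup>2"
          using power_mono[of "\<bar>u\<^sup>2 - 1\<bar>" "17/64" 2] by simp
        also have "\<dots> \<le> 1/8" by (simp add: power2_eq_square)
        finally have "((t (move k l x))\<^sup>2 - 1)\<^sup>2 \<le> 1/8" by (simp add: u_def)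
        moreover have "0 \<le> \<delta> * W (move k l x)" using \<delta> W by simp
        ultimately show ?thesis using False by (simp add: \<psi>_def \<phi>_def)
      qed
      then show "\<phi> (move k l x) - \<phi> x \<le> \<psi> (move k l x) - \<psi> x" using \<phi>x by simp
    qed
    moreover have "gen q \<phi> x = gen q (\<lambda>x. ((t x)\<^sup>2 - 1)\<^sup>2 - 1/8) x - \<delta> * gen q W x"
      unfolding \<phi>_def by (rule gen_diff_scaled)
    moreover have "\<delta> * gen q W x \<le> \<delta> * (K - \<kappa> * W x)"
      using lyap[of x] xi \<delta> by (intro mult_left_mono) auto
    moreover have "(6 * (t x)\<^sup>2 - 2 - 4 * \<theta>) * \<theta>\<^sup>2 * qvar q c x \<le> gen q (\<lambda>x. ((t x)\<^sup>2 - 1)\<^sup>2 - 1/8) x"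
    proof -
      have "(4 * t x ^ 3 - 4 * t x) * \<theta> * drift q c x + (6 * (t x)\<^sup>2 - 2 - 4 * \<theta>) * \<theta>\<^sup>2 * qvar q c x
        \<le> gen q (\<lambda>x. ((t x)\<^sup>2 - 1)\<^sup>2 - 1/8) x"
      proof (rule gen_ge_of_quadratic[OF q])
        fix k l assume en: "enabled k x"
        show "(4 * t x ^ 3 - 4 * t x) * \<theta> * (wt c l - wt c k)
            + (6 * (t x)\<^sup>2 - 2 - 4 * \<theta>) * \<theta>\<^sup>2 * (wt c l - wt c k)\<^sup>2
            \<le> ((t (move k l x))\<^sup>2 - 1)\<^sup>2 - 1/8 - (((t x)\<^sup>2 - 1)\<^sup>2 - 1/8)"
          using quartic_bump_increment[OF less_imp_le[OF tx] h_le[of l k]]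
          unfolding t_move[OF en] by (simp add: power_mult_distrib mult.assoc)
      qed
      then show ?thesis using martingale[of x] xi by simp
    qed
    ultimately have ge: "(6 * (t x)\<^sup>2 - 2 - 4 * \<theta>) * (\<theta>\<^sup>2 * qvar q c x) - \<theta>\<^sup>2 * \<sigma> / 2 + \<delta> * \<kappa> * W x \<le> gen q \<psi> x"
      using \<delta>(2) by (simp add: algebra_simps)
    have v1: "\<theta>\<^sup>2 * \<sigma> \<le> \<theta>\<^sup>2 * qvar q c x"
      unfolding \<sigma>_def by (intro mult_left_mono qvar_ge q) auto
    have v2: "\<theta>\<^sup>2 * qvar q c x \<le> \<theta>\<^sup>2 * Q"
      using qvar_le[where x=x, OF q jump] unfolding Q_def by (intro mult_left_mono) auto
    have v0: "0 \<le> \<theta>\<^sup>2 * \<sigma>" using \<sigma> by simp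
    have nn: "0 \<le> \<delta> * \<kappa> * W x" using \<delta> K W by simp
    \<comment> \<open>The negative terms are paid for by convexity of the bump near the edges, by
      the Lyapunov term where \<open>W\<close> is large, and otherwise by
      \<open>\<epsilon> * \<phi> x\<close>, since then \<open>\<phi> x\<close> is at least
      1/16.\<close>
    consider "1/2 \<le> (t x)\<^sup>2" | "(t x)\<^sup>2 < 1/2" "1/16 \<le> \<delta> * W x" | "(t x)\<^sup>2 < 1/2" "\<delta> * W x < 1/16"
      by linarith
    then have "- \<epsilon> * \<phi> x \<le> gen q \<psi> x"
    proof cases
      case 1
      have "1/2 * (\<theta>\<^sup>2 * qvar q c x) \<le> (6 * (t x)\<^sup>2 - 2 - 4 * \<theta>) * (\<theta>\<^sup>2 * qvar q c x)"
        using 1 \<theta>8 v0 v1 by (intro mult_right_mono) auto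
      then have "0 \<le> gen q \<psi> x" using ge v1 nn by linarith
      moreover have "0 \<le> \<epsilon> * \<phi> x" using eps \<phi>x by simp
      ultimately show ?thesis by simp
    next
      case 2
      have "(- 3) * (\<theta>\<^sup>2 * qvar q c x) \<le> (6 * (t x)\<^sup>2 - 2 - 4 * \<theta>) * (\<theta>\<^sup>2 * qvar q c x)"
        using \<theta>8 v0 v1 zero_le_power2[of "t x"] by (intro mult_right_mono) linarith+
      moreover have "\<kappa> * (1/16) \<le> \<kappa> * (\<delta> * W x)" using K 2 by (intro mult_left_mono) auto
      ultimately have "0 \<le> gen q \<psi> x" using ge v2 small(1) by (simp add: mult.commute mult.left_commute)
      moreover have "0 \<le> \<epsilon> * \<phi> x" using eps \<phi>x by simp
      ultimately show ?thesis by simp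
    next
      case 3
      have "(- 3) * (\<theta>\<^sup>2 * qvar q c x) \<le> (6 * (t x)\<^sup>2 - 2 - 4 * \<theta>) * (\<theta>\<^sup>2 * qvar q c x)"
        using \<theta>8 v0 v1 zero_le_power2[of "t x"] by (intro mult_right_mono) linarith+
      moreover have "(1/2)\<^sup>2 \<le> (1 - (t x)\<^sup>2)\<^sup>2" using 3 by (intro power_mono) auto
      then have "1/16 \<le> \<phi> x"
        using 3 unfolding \<phi>_def power2_commute[of 1 "(t x)\<^sup>2"] by (simp add: power2_eq_square)
      then have "\<epsilon> * (1/16) \<le> \<epsilon> * \<phi> x" using eps by (intro mult_left_mono) auto
      ultimately show ?thesis using ge v2 small(2) nn by (simp add: mult.commute mult.left_commute)
    qed
    then show ?thesis using \<phi>x by simp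
  qed
  have "0 \<le> \<psi> x" for x unfolding \<psi>_def by simp
  then show ?thesis using fin nz supp_N main by blast
qed

section \<open>The routing chain\<close>

text \<open>On the set where a negative minimum is attained, \<open>escape\<close> yields a state
  that loses mass or leads to a larger value, contradicting \<open>super\<close> there.
  Superharmonicity is asked for only where \<open>g\<close> is negative, which allows exceptional
  states with a known sign.\<close>

lemma min_principle:
  fixes A :: "'d::finite \<Rightarrow> 'd \<Rightarrow> real" and g :: "'d \<Rightarrow> real"
  assumes nonneg: "\<And>k l. 0 \<le> A k l" and row: "\<And>k. (\<Sum>l\<in>UNIV. A k l) \<le> 1"
    and escape: "\<And>C. C \<noteq> {} \<Longrightarrow> \<exists>k\<in>C. (\<Sum>l\<in>UNIV. A k l) < 1 \<or> (\<exists>l. l \<notin> C \<and> 0 < A k l)"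
    and super: "\<And>k. 0 \<le> g k \<or> (\<Sum>l\<in>UNIV. A k l * g l) \<le> g k"
  shows "0 \<le> g k"
proof (rule ccontr)
  assume neg: "\<not> 0 \<le> g k"
  define m where "m = Min (range g)"
  have m: "m \<le> g l" for l unfolding m_def by simp
  have m0: "m < 0" using m[of k] neg by simp
  have "m \<in> range g" unfolding m_def by (intro Min_in) auto
  then have "{l. g l = m} \<noteq> {}" by auto
  from escape[OF this] obtain k where k: "g k = m" "(\<Sum>l\<in>UNIV. A k l) < 1 \<or> (\<exists>l. l \<notin> {l. g l = m} \<and> 0 < A k l)"
    by auto
  have "(\<Sum>l\<in>UNIV. A k l * g l) \<le> m" using super[of k] k(1) m0 by auto
  then have le: "(\<Sum>l\<in>UNIV. A k l * (g l - m)) \<le> m * (1 - (\<Sum>l\<in>UNIV. A k l))"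

    by (simp add: right_diff_distrib sum_subtractf sum_distrib_left mult.commute)
  have ge: "0 \<le> A k l * (g l - m)" for l using nonneg[of k l] m[of l] by simp
  from k(2) show False
  proof
    assume "(\<Sum>l\<in>UNIV. A k l) < 1"
    then have "m * (1 - (\<Sum>l\<in>UNIV. A k l)) < 0" using m0 by (intro mult_neg_pos) auto
    then show False using le sum_nonneg[of UNIV "\<lambda>l. A k l * (g l - m)"] ge by simp
  next
    assume "\<exists>l. l \<notin> {l. g l = m} \<and> 0 < A k l"
    then obtain l where l: "g l \<noteq> m" "0 < A k l" by auto
    then have "0 < A k l * (g l - m)" using m[of l] by (intro mult_pos_pos) auto
    also have "\<dots> \<le> (\<Sum>l\<in>UNIV. A k l * (g l - m))" using ge by (intro member_le_sum) auto
    also have "\<dots> \<le> 0" using le row[of k] m0 by (smt (verit) mult_nonpos_nonneg)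
    finally show False by simp
  qed
qed

section \<open>Consequences of irreducibility\<close>

lemma sum_pos_exists:
  fixes f :: "'a \<Rightarrow> real"
  assumes "0 < sum f A"
  shows "\<exists>a\<in>A. 0 < f a"
proof (rule ccontr)
  assume "\<not> (\<exists>a\<in>A. 0 < f a)"
  then have "sum f A \<le> 0" by (intro sum_nonpos) (auto simp: not_less)
  then show False using assms by simp
qed

lemma jump_kernel_pos_cases:
  fixes lam mu :: "'d::finite \<Rightarrow> real"
  assumes "0 < jump_kernel lam mu P z"
  obtains (arrival) i where "z = unitv i" "0 < lam i"
    | (departure) i where "z = (\<lambda>k. - unitv i k)" "0 < mu i * p0 P i"
    | (transfer) i j where "z = (\<lambda>k. unitv j k - unitv i k)" "0 < mu i * P$i$j"
proof -
  have "\<exists>i. 0 < (if z = unitv i then lam i else 0)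
              + (if z = (\<lambda>k. - unitv i k) then mu i * p0 P i else 0)
              + (\<Sum>j\<in>UNIV. if j \<noteq> i \<and> z = (\<lambda>k. unitv j k - unitv i k) then mu i * P$i$j else 0)"
    using sum_pos_exists[OF assms[unfolded jump_kernel_def]] by simp
  then obtain i where "0 < (if z = unitv i then lam i else 0)
      \<or> 0 < (if z = (\<lambda>k. - unitv i k) then mu i * p0 P i else 0)
      \<or> 0 < (\<Sum>j\<in>UNIV. if j \<noteq> i \<and> z = (\<lambda>k. unitv j k - unitv i k) then mu i * P$i$j else 0)"
    by (smt (verit))
  then consider "0 < (if z = unitv i then lam i else 0)"
    | "0 < (if z = (\<lambda>k. - unitv i k) then mu i * p0 P i else 0)"
    | "0 < (\<Sum>j\<in>UNIV. if j \<noteq> i \<and> z = (\<lambda>k. unitv j k - unitv i k) then mu i * P$i$j else 0)" by blast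
  then show ?thesis
  proof cases
    case 1 then show ?thesis using arrival by (auto split: if_splits)
  next
    case 2 then show ?thesis using departure by (auto split: if_splits)
  next
    case 3
    then obtain j where "0 < (if j \<noteq> i \<and> z = (\<lambda>k. unitv j k - unitv i k) then mu i * P$i$j else 0)"
      using sum_pos_exists by blast
    then show ?thesis using transfer by (auto split: if_splits)
  qed
qed

lemma sum_unitv: "finite C \<Longrightarrow> (\<Sum>k\<in>C. unitv i k) = (if i \<in> C then 1 else 0)"
  unfolding unitv_def by (simp add: sum.delta)

text \<open>If no jump changed the population of \<open>C\<close> in the direction
  \<open>- e\<close>, no path could lead from the origin to \<open>- e\<close> times the unit vector
  of a node in \<open>C\<close>.\<close>

lemma irreducible_not_monotone:
  fixes C :: "'d::finite set"
  assumes irr: "jackson_irreducible lam mu P" and C: "C \<noteq> {}" and e: "e = 1 \<or> e = -1"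
  shows "\<exists>z. 0 < jump_kernel lam mu P z \<and> e * (\<Sum>k\<in>C. z k) < 0"
proof (rule ccontr)
  assume "\<nexists>z. 0 < jump_kernel lam mu P z \<and> e * (\<Sum>k\<in>C. z k) < 0"
  then have mono: "0 \<le> e * (\<Sum>k\<in>C. z k)" if "0 < jump_kernel lam mu P z" for z
    using that by (meson not_less)
  obtain i where i: "i \<in> C" using C by blast
  have "((\<lambda>_. 0), (\<lambda>k. - e * unitv i k)) \<in> {(u, v). jump_kernel lam mu P (\<lambda>k. v k - u k) > 0}\<^sup>*"
    using irr unfolding jackson_irreducible_def by blast
  then have "0 \<le> e * (\<Sum>k\<in>C. - e * unitv i k)"
  proof (induction rule: rtrancl_induct)
    case (step u v)
    then show ?case
      using mono[of "\<lambda>k. v k - u k"] by (simp add: sum_subtractf right_diff_distrib)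
  qed simp
  also have "\<dots> = - e * e"
    using i by (simp add: sum_negf sum_distrib_left[symmetric] sum_unitv)
  finally show False using e by auto
qed

text \<open>Here \<open>m\<close>, \<open>n\<close>, \<open>M\<close>, \<open>N\<close> stand for
  the square roots of the service and traffic rates at \<open>i\<close> and at another queue. With
  \<open>a = m - n\<close>, expanding the left side and inserting the bounds on \<open>X\<close>,
  \<open>Y\<close> and \<open>X * Y\<close> gives strictly less than
  \<open>(N + a * R)\<^sup>2\<close>, and \<open>N + a * R \<le> M\<close>.\<close>

lemma stability_arith:
  fixes m n M N X Y R :: real
  assumes "0 < n" "n < m" "0 < N" "N < M" "0 \<le> R" and "(m - n) * R \<le> M - N"
    and X: "n * X \<le> N * R" and Y: "N * Y \<le> n * R" and XY: "X * Y < R\<^sup>2"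
  shows "(N\<^sup>2 + n * (m - n) * X) * (1 + (m - n) / n * Y) < M\<^sup>2"
proof -
  define a where "a = m - n"
  have a: "0 < a" "a * R \<le> M - N" using assms by (auto simp: a_def)
  have "N * (N * Y) \<le> N * (n * R)" using Y assms by (intro mult_left_mono) auto
  then have Y': "N\<^sup>2 * Y / n \<le> N * R" using assms by (simp add: pos_divide_le_eq power2_eq_square mult.commute mult.left_commute)
  have "(N\<^sup>2 + n * a * X) * (1 + a / n * Y) = N\<^sup>2 + a * (n * X + N\<^sup>2 * Y / n) + a\<^sup>2 * (X * Y)"
    using assms by (simp add: field_simps power2_eq_square)
  also have "\<dots> < N\<^sup>2 + a * (N * R + N * R) + a\<^sup>2 * R\<^sup>2"
  proof -
    have "a * (n * X + N\<^sup>2 * Y / n) \<le> a * (N * R + N * R)" using a X Y' by (intro mult_left_mono) auto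
    moreover have "a\<^sup>2 * (X * Y) < a\<^sup>2 * R\<^sup>2" using a XY by (intro mult_strict_left_mono) auto
    ultimately show ?thesis by linarith
  qed
  also have "\<dots> = (N + a * R)\<^sup>2" by (simp add: power2_eq_square algebra_simps)
  also have "\<dots> \<le> M\<^sup>2" using a assms by (intro power_mono) auto
  finally show ?thesis unfolding a_def .
qed

locale jackson_network =
  fixes lam mu nu :: "'d::finite \<Rightarrow> real" and P :: "real^'d^'d"
  assumes lam_nonneg: "0 \<le> lam i"
    and mu_pos: "0 < mu i"
    and P_nonneg: "0 \<le> P$i$j"
    and P_diag: "P$i$i = 0"
    and P_substoch: "(\<Sum>j\<in>UNIV. P$i$j) \<le> 1"
    and irreducible: "jackson_irreducible lam mu P"
    and traffic: "nu j = lam j + (\<Sum>i\<in>UNIV. nu i * P$i$j)"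
    and stable: "nu i < mu i"
begin

lemma p0_nonneg: "0 \<le> p0 P i"
  using P_substoch[of i] by (simp add: p0_def)

text \<open>A jump that lowers the population of \<open>C\<close> is a departure from
  \<open>C\<close> or a transfer out of it.\<close>

lemma exits:
  assumes "C \<noteq> {}"
  shows "\<exists>k\<in>C. (\<Sum>l\<in>UNIV. P$k$l) < 1 \<or> (\<exists>l. l \<notin> C \<and> 0 < P$k$l)"
proof -
  obtain z where z: "0 < jump_kernel lam mu P z" "(\<Sum>k\<in>C. z k) < 0"
    using irreducible_not_monotone[OF irreducible assms, of 1] by auto
  from z(1) show ?thesis
  proof (cases rule: jump_kernel_pos_cases)
    case (arrival i)
    then show ?thesis using z(2) by (simp add: sum_unitv split: if_splits)
  next
    case (departure i)
    then show ?thesis using z(2) mu_pos[of i]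
      by (auto simp: sum_negf sum_unitv p0_def zero_less_mult_iff split: if_splits)
  next
    case (transfer i j)
    then show ?thesis using z(2) mu_pos[of i]
      by (auto simp: sum_subtractf sum_unitv zero_less_mult_iff split: if_splits)
  qed
qed

lemma enters:
  assumes "C \<noteq> {}"
  shows "\<exists>k\<in>C. 0 < lam k \<or> (\<exists>l. l \<notin> C \<and> 0 < P$l$k)"
proof -
  obtain z where z: "0 < jump_kernel lam mu P z" "(\<Sum>k\<in>C. z k) > 0"
    using irreducible_not_monotone[OF irreducible assms, of "-1"] by auto
  from z(1) show ?thesis
  proof (cases rule: jump_kernel_pos_cases)
    case (arrival i)
    then show ?thesis using z(2) by (auto simp: sum_unitv split: if_splits)
  next
    case (departure i)
    then show ?thesis using z(2) by (simp add: sum_negf sum_unitv split: if_splits)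
  next
    case (transfer i j)
    then show ?thesis using z(2) mu_pos[of i]
      by (auto simp: sum_subtractf sum_unitv zero_less_mult_iff split: if_splits)
  qed
qed

section \<open>Green matrix and traffic rates\<close>

lemma P_min_principle:
  assumes "\<And>k. 0 \<le> g k \<or> (\<Sum>l\<in>UNIV. P$k$l * g l) \<le> g k"
  shows "0 \<le> g k"
  by (rule min_principle[where A="\<lambda>k l. P$k$l" and g=g]) (rule P_nonneg P_substoch exits assms, assumption?)+

text \<open>The Green matrix of the routing chain: the expected number of visits to \<open>j\<close>
  by a customer starting at \<open>k\<close>.\<close>

definition G :: "'d \<Rightarrow> 'd \<Rightarrow> real" where
  "G k j = matrix_inv (mat 1 - P) $ k $ j"

text \<open>A kernel vector is harmonic for \<open>P\<close>, and so is its negative; the minimum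
  principle makes both nonnegative.\<close>

lemma invertible_I_minus_P: "invertible (mat 1 - P)"
proof -
  have "v = 0" if "(mat 1 - P) *v v = 0" for v :: "real^'d"
  proof -
    have fixed: "(\<Sum>l\<in>UNIV. P$k$l * v$l) = v $ k" for k
    proof -
      have "v - P *v v = 0" using that by (simp add: matrix_vector_mult_diff_rdistrib)
      then have "v $ k = (P *v v) $ k" by simp
      then show ?thesis by (simp add: matrix_vector_mult_def)
    qed
    have "0 \<le> v $ k" for k
      by (rule P_min_principle) (simp add: fixed)
    moreover have "0 \<le> - v $ k" for k
      by (rule P_min_principle) (simp add: fixed sum_negf)
    ultimately have "v $ k = 0" for k by (metis neg_0_le_iff_le order_antisym)
    then show ?thesis by (simp add: vec_eq_iff)
  qed
  then show ?thesis by (simp add: invertible_left_inverse matrix_left_invertible_ker)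
qed

lemma matrix_inv_I_minus_P:
  "(mat 1 - P) ** matrix_inv (mat 1 - P) = mat 1" "matrix_inv (mat 1 - P) ** (mat 1 - P) = mat 1"
  using someI_ex[OF invertible_I_minus_P[unfolded invertible_def]] unfolding matrix_inv_def by auto

lemma G_right: "G k j = (if k = j then 1 else 0) + (\<Sum>l\<in>UNIV. P$k$l * G l j)"
proof -
  have "((mat 1 - P) ** matrix_inv (mat 1 - P)) $ k $ j
      = (\<Sum>l\<in>UNIV. (if k = l then G l j else 0) - P$k$l * G l j)"
    unfolding matrix_matrix_mult_def by (auto simp: G_def mat_def left_diff_distrib intro!: sum.cong)
  also have "\<dots> = G k j - (\<Sum>l\<in>UNIV. P$k$l * G l j)" by (simp add: sum_subtractf)
  finally show ?thesis unfolding matrix_inv_I_minus_P by (simp add: mat_def)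
qed

lemma G_left: "G k j = (if k = j then 1 else 0) + (\<Sum>l\<in>UNIV. G k l * P$l$j)"
proof -
  have "(matrix_inv (mat 1 - P) ** (mat 1 - P)) $ k $ j
      = (\<Sum>l\<in>UNIV. (if l = j then G k l else 0) - G k l * P$l$j)"
    unfolding matrix_matrix_mult_def by (auto simp: G_def mat_def right_diff_distrib intro!: sum.cong)
  also have "\<dots> = G k j - (\<Sum>l\<in>UNIV. G k l * P$l$j)" by (simp add: sum_subtractf)
  finally show ?thesis unfolding matrix_inv_I_minus_P by (simp add: mat_def)
qed

lemma G_nonneg: "0 \<le> G k j"
proof (rule P_min_principle[where g="\<lambda>k. G k j"])
  show "0 \<le> G k j \<or> (\<Sum>l\<in>UNIV. P$k$l * G l j) \<le> G k j" for k
    by (subst (3) G_right) simp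
qed

lemma G_diag_ge_1: "1 \<le> G j j"
proof -
  have "0 \<le> (\<Sum>l\<in>UNIV. P$j$l * G l j)" by (intro sum_nonneg mult_nonneg_nonneg G_nonneg P_nonneg)
  then show ?thesis using G_right[of j j] by simp
qed

text \<open>Multiplying the traffic equations by column \<open>m\<close> of \<open>G\<close> and
  applying \<open>G_right\<close> cancels all traffic rates except \<open>nu m\<close>.\<close>

lemma nu_eq: "nu m = (\<Sum>k\<in>UNIV. lam k * G k m)"
proof -
  have "(\<Sum>j\<in>UNIV. nu j * G j m) = (\<Sum>j\<in>UNIV. lam j * G j m) + (\<Sum>j\<in>UNIV. (\<Sum>i\<in>UNIV. nu i * P$i$j) * G j m)"
    unfolding sum.distrib[symmetric]
    by (intro sum.cong refl) (metis traffic distrib_right)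
  also have "(\<Sum>j\<in>UNIV. (\<Sum>i\<in>UNIV. nu i * P$i$j) * G j m) = (\<Sum>i\<in>UNIV. nu i * (\<Sum>j\<in>UNIV. P$i$j * G j m))"
    unfolding sum_distrib_right sum_distrib_left by (subst sum.swap) (simp add: mult.assoc)
  also have "\<dots> = (\<Sum>i\<in>UNIV. nu i * G i m - (if i = m then nu m else 0))"
  proof (intro sum.cong refl)
    fix i
    show "nu i * (\<Sum>j\<in>UNIV. P$i$j * G j m) = nu i * G i m - (if i = m then nu m else 0)"
      using G_right[of i m] by (cases "i = m") (simp_all only: if_True if_False, simp_all add: distrib_left)
  qed
  finally show ?thesis by (simp add: sum_subtractf)
qed

text \<open>The zero set of \<open>nu\<close> could receive neither arrivals nor transfers from
  outside it, against \<open>enters\<close>.\<close>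

lemma nu_pos: "0 < nu m"
proof (rule ccontr)
  have nn: "0 \<le> nu m" for m unfolding nu_eq by (intro sum_nonneg mult_nonneg_nonneg lam_nonneg G_nonneg)
  assume "\<not> 0 < nu m"
  then have "{m. nu m = 0} \<noteq> {}" using nn[of m] by auto
  from enters[OF this] obtain k where k: "nu k = 0" "0 < lam k \<or> (\<exists>l. nu l \<noteq> 0 \<and> 0 < P$l$k)" by auto
  have s: "0 \<le> nu i * P$i$k" for i using nn P_nonneg by simp
  then have s': "0 \<le> (\<Sum>i\<in>UNIV. nu i * P$i$k)" by (intro sum_nonneg)
  have "nu l * P$l$k \<le> 0" for l
    using member_le_sum[of l UNIV "\<lambda>i. nu i * P$i$k"] s traffic[of k] k(1) lam_nonneg[of k] by simp
  moreover have "lam k \<le> 0" using traffic[of k] k(1) s' by simp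
  ultimately show False using k(2) nn by (metis less_eq_real_def not_less mult_pos_pos)
qed

text \<open>To be counted at \<open>j\<close> a customer must first reach \<open>j\<close>. In the
  proof, \<open>G j j - G k j\<close> vanishes at \<open>k = j\<close> and is superharmonic
  elsewhere.\<close>

lemma G_le_diag: "G k j \<le> G j j"
proof -
  have "0 \<le> G j j - G k j"
  proof (rule P_min_principle[where g="\<lambda>k. G j j - G k j"])
    fix k
    have "(\<Sum>l\<in>UNIV. P$k$l * (G j j - G l j)) = (\<Sum>l\<in>UNIV. P$k$l) * G j j - (\<Sum>l\<in>UNIV. P$k$l * G l j)"
      by (simp add: right_diff_distrib sum_subtractf sum_distrib_right)
    moreover have "(\<Sum>l\<in>UNIV. P$k$l) * G j j \<le> 1 * G j j"
      by (intro mult_right_mono P_substoch G_nonneg)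
    moreover have "k = j \<or> G k j = (\<Sum>l\<in>UNIV. P$k$l * G l j)"
      using G_right[of k j] by auto
    ultimately show "0 \<le> G j j - G k j \<or> (\<Sum>l\<in>UNIV. P$k$l * (G j j - G l j)) \<le> G j j - G k j"
      by (elim disjE) simp_all
  qed
  then show ?thesis by simp
qed

text \<open>The same bound for the time-reversed routing matrix, whose entries are
  \<open>\<nu>\<^sub>l P\<^sub>l\<^sub>k / \<nu>\<^sub>k\<close>.\<close>
lemma nu_G_le_diag: "nu i * G i j \<le> nu j * G i i"
proof -
  have ne: "nu k \<noteq> 0" for k using nu_pos[of k] by simp
  have row: "(\<Sum>l\<in>UNIV. nu l * P$l$k / nu k) = 1 - lam k / nu k" for k
  proof -
    have "(\<Sum>l\<in>UNIV. nu l * P$l$k) = nu k - lam k" using traffic[of k] by linarith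
    then show ?thesis using ne[of k] by (simp add: sum_divide_distrib[symmetric] diff_divide_distrib)
  qed
  have "0 \<le> G i i - nu i * G i j / nu j"
  proof (rule min_principle[where A="\<lambda>k l. nu l * P$l$k / nu k" and g="\<lambda>j. G i i - nu i * G i j / nu j"])
    show "0 \<le> nu l * P$l$k / nu k" for k l using nu_pos P_nonneg by (simp add: less_imp_le)
    show "(\<Sum>l\<in>UNIV. nu l * P$l$k / nu k) \<le> 1" for k
      unfolding row using nu_pos lam_nonneg by (simp add: less_imp_le)
    \<comment> \<open>Leaving \<open>C\<close> backwards in time is entering it forwards, and row
      \<open>k\<close> of the reversed matrix loses mass \<open>lam k / nu k\<close>.\<close>
    show "\<exists>k\<in>C. (\<Sum>l\<in>UNIV. nu l * P$l$k / nu k) < 1 \<or> (\<exists>l. l \<notin> C \<and> 0 < nu l * P$l$k / nu k)"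
      if "C \<noteq> {}" for C
      using enters[OF that] nu_pos unfolding row by (auto intro!: bexI mult_pos_pos divide_pos_pos)
  next
    fix k
    have "(\<Sum>l\<in>UNIV. nu l * P$l$k / nu k * (G i i - nu i * G i l / nu l))
        = (\<Sum>l\<in>UNIV. nu l * P$l$k / nu k) * G i i - (\<Sum>l\<in>UNIV. nu i * (G i l * P$l$k) / nu k)"
      unfolding sum_distrib_right sum_subtractf[symmetric]
      using ne by (intro sum.cong refl) (simp add: field_simps)
    also have "(\<Sum>l\<in>UNIV. nu i * (G i l * P$l$k) / nu k) = nu i * (\<Sum>l\<in>UNIV. G i l * P$l$k) / nu k"
      by (simp add: sum_distrib_left sum_divide_distrib)
    finally have "(\<Sum>l\<in>UNIV. nu l * P$l$k / nu k * (G i i - nu i * G i l / nu l))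
        = (1 - lam k / nu k) * G i i - nu i * (\<Sum>l\<in>UNIV. G i l * P$l$k) / nu k"
      unfolding row .
    moreover have "(1 - lam k / nu k) * G i i \<le> 1 * G i i"
      using nu_pos[of k] lam_nonneg[of k] G_nonneg by (intro mult_right_mono) auto
    moreover have "k = i \<or> G i k = (\<Sum>l\<in>UNIV. G i l * P$l$k)"
      using G_left[of i k] by auto
    ultimately show "0 \<le> G i i - nu i * G i k / nu k \<or>
      (\<Sum>l\<in>UNIV. nu l * P$l$k / nu k * (G i i - nu i * G i l / nu l)) \<le> G i i - nu i * G i k / nu k"
      using ne[of k] by (elim disjE) simp_all
  qed
  then show ?thesis using nu_pos[of j] by (simp add: field_simps)
qed

end

section \<open>The twisted network at the bottleneck\<close>

lemma exp_le_quadratic: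
  fixes x :: real
  assumes "\<bar>x\<bar> \<le> 1"
  shows "exp x \<le> 1 + x + x\<^sup>2"
proof (cases "0 \<le> x")
  case True
  then show ?thesis using assms exp_bound[of x] by simp
next
  case False
  have "1 - x \<le> exp (- x)" using exp_ge_add_one_self[of "- x"] by simp
  then have "inverse (exp (- x)) \<le> inverse (1 - x)" using False by (intro le_imp_inverse_le) auto
  then have "exp x \<le> inverse (1 - x)" by (simp add: exp_minus)
  also have "\<dots> \<le> 1 + x + x\<^sup>2"
  proof -
    have "x ^ 3 \<le> 0" using False by (simp add: power3_eq_cube mult_nonneg_nonpos)
    then have "1 \<le> (1 + x + x\<^sup>2) * (1 - x)" by (simp add: algebra_simps power2_eq_square power3_eq_cube)
    then show ?thesis using False by (simp add: inverse_eq_divide pos_divide_le_eq)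
  qed
  finally show ?thesis .
qed

text \<open>Beyond \<open>s0\<close> the ratio \<open>exp ((1 - \<rho>) * s)\<close> exceeds
  \<open>A / B\<close>; up to \<open>s0\<close> the left side is bounded.\<close>

lemma exp_absorb_smaller_rate:
  fixes \<rho> A B :: real
  assumes "\<rho> < 1" "0 \<le> A" "0 < B"
  shows "\<exists>K0>0. \<forall>s\<ge>0. A * exp (\<rho> * s) \<le> B * exp s + K0"
proof -
  define s0 where "s0 = A / B / (1 - \<rho>)"
  have s0: "0 \<le> s0" "A / B = (1 - \<rho>) * s0" unfolding s0_def using assms by auto
  have "A * exp (\<rho> * s) \<le> B * exp s + (A * exp s0 + 1)" if s: "0 \<le> s" for s
  proof (cases "s \<le> s0")
    case True
    have "\<rho> * s \<le> 1 * s" using s assms by (intro mult_right_mono) auto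
    then have "A * exp (\<rho> * s) \<le> A * exp s0" using True assms by (intro mult_left_mono) auto
    then show ?thesis using assms by (simp add: add_increasing)
  next
    case False
    have "A / B \<le> (1 - \<rho>) * s" unfolding s0 using False assms by (intro mult_left_mono) auto
    also have "\<dots> \<le> exp ((1 - \<rho>) * s)" using exp_ge_add_one_self[of "(1 - \<rho>) * s"] by linarith
    finally have "A \<le> B * exp ((1 - \<rho>) * s)" using assms by (simp add: pos_divide_le_eq mult.commute)
    then have "A * exp (\<rho> * s) \<le> B * exp ((1 - \<rho>) * s) * exp (\<rho> * s)" by (intro mult_right_mono) auto
    also have "\<dots> = B * exp s" by (simp add: mult.assoc exp_add[symmetric] algebra_simps)
    finally show ?thesis using assms by (simp add: add_increasing2)
  qed
  moreover have "0 < A * exp s0 + 1" using assms by (simp add: add_nonneg_pos)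
  ultimately show ?thesis by blast
qed

locale jackson_bottleneck = jackson_network lam mu nu P
  for lam mu nu :: "'d::finite \<Rightarrow> real" and P :: "real^'d^'d" +
  fixes i :: 'd
  assumes bottleneck: "(sqrt (mu i) - sqrt (nu i))\<^sup>2 / G i i \<le> (sqrt (mu j) - sqrt (nu j))\<^sup>2 / G j j"
begin

text \<open>\<open>h k\<close> is the probability that a customer at \<open>k\<close> ever visits \<open>i\<close>; \<open>G_killed j k\<close> is the
  expected number of visits to \<open>j\<close> from \<open>k\<close> before \<open>i\<close>.\<close>
definition h :: "'d \<Rightarrow> real" where "h k = G k i / G i i"
text \<open>The critical point of \<open>b * nu i + mu i / b\<close>. The resulting balance
  \<open>mu i / b = b * nu i\<close> is what removes the drift in \<open>drift_c\<close>.\<close>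

definition b :: real where "b = sqrt (mu i / nu i)"
definition beta :: "'d \<Rightarrow> real" where "beta k = 1 + (b - 1) * h k"
definition G_killed :: "'d \<Rightarrow> 'd \<Rightarrow> real" where "G_killed j k = G k j - h k * G i j"
definition decay :: real where "decay = (sqrt (mu i) - sqrt (nu i))\<^sup>2 / G i i"

section \<open>Hitting probabilities of the bottleneck and the killed Green matrix\<close>

lemma G_pos: "0 < G j j" using G_diag_ge_1[of j] by simp

lemma h_i [simp]: "h i = 1" using G_pos[of i] by (simp add: h_def)

lemma h_bounds: "0 \<le> h k" "h k \<le> 1"
  using G_pos[of i] G_nonneg[of k i] G_le_diag[of k i] by (simp_all add: h_def)

text \<open>The defect \<open>1 / G i i\<close> at \<open>i\<close> is the probability that a
  customer leaving \<open>i\<close> never returns.\<close>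

lemma h_harmonic: "(\<Sum>l\<in>UNIV. P$k$l * h l) = h k - (if k = i then 1 / G i i else 0)"
proof -
  have "(\<Sum>l\<in>UNIV. P$k$l * h l) = (\<Sum>l\<in>UNIV. P$k$l * G l i) / G i i"
    by (simp add: h_def sum_divide_distrib)
  also have "(\<Sum>l\<in>UNIV. P$k$l * G l i) = G k i - (if k = i then 1 else 0)"
    using G_right[of k i] by linarith
  finally show ?thesis by (simp add: h_def diff_divide_distrib)
qed

lemma b_eq: "b = sqrt (mu i) / sqrt (nu i)" by (simp add: b_def real_sqrt_divide)

lemma sqrt_nu_less: "0 < sqrt (nu j)" "sqrt (nu j) < sqrt (mu j)"
  using nu_pos[of j] stable[of j] by simp_all

lemma b_gt_1: "1 < b" using sqrt_nu_less[of i] by (simp add: b_eq)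

lemma mu_div_b: "mu i / b = sqrt (mu i) * sqrt (nu i)"
proof -
  have "sqrt (mu i) * sqrt (mu i) = mu i" using mu_pos[of i] by simp
  then have "mu i / b = (sqrt (mu i) * sqrt (mu i)) / (sqrt (mu i) / sqrt (nu i))" by (simp add: b_eq)
  also have "\<dots> = sqrt (mu i) * sqrt (nu i)" using sqrt_nu_less[of i] by (simp add: field_simps)
  finally show ?thesis .
qed

lemma beta_ge_1: "1 \<le> beta k" using b_gt_1 h_bounds[of k] by (simp add: beta_def)

lemma beta_pos: "0 < beta k" using beta_ge_1[of k] by simp

lemma beta_i [simp]: "beta i = b" by (simp add: beta_def)

text \<open>\<open>beta\<close> is affine in \<open>h\<close> and takes the value 1 outside the
  network, so only the defect of \<open>h\<close> at \<open>i\<close> survives, scaled by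
  \<open>b - 1\<close>.\<close>

lemma beta_harmonic:
  "p0 P k + (\<Sum>l\<in>UNIV. P$k$l * beta l) = beta k - (if k = i then (b - 1) / G i i else 0)"
proof -
  have eq: "(\<Sum>l\<in>UNIV. P$k$l * beta l) = (\<Sum>l\<in>UNIV. P$k$l) + (b - 1) * (\<Sum>l\<in>UNIV. P$k$l * h l)"
    by (simp add: beta_def algebra_simps sum.distrib sum_subtractf sum_distrib_left)
  show ?thesis
    unfolding eq h_harmonic p0_def by (simp add: beta_def algebra_simps diff_divide_distrib)
qed

lemma sum_lam_h: "(\<Sum>l\<in>UNIV. lam l * h l) = nu i / G i i"
  by (simp add: h_def nu_eq sum_divide_distrib)

lemma G_killed_i [simp]: "G_killed j i = 0" by (simp add: G_killed_def)

lemma G_killed_target_i [simp]: "G_killed i k = 0" using G_pos[of i] by (simp add: G_killed_def h_def)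

lemma G_killed_right:
  "(\<Sum>l\<in>UNIV. P$k$l * G_killed j l) = G_killed j k - (if k = j then 1 else 0) + (if k = i then G i j / G i i else 0)"
proof -
  have "(\<Sum>l\<in>UNIV. P$k$l * G_killed j l) = (\<Sum>l\<in>UNIV. P$k$l * G l j) - (\<Sum>l\<in>UNIV. P$k$l * h l) * G i j"
    by (simp add: G_killed_def right_diff_distrib sum_subtractf sum_distrib_right mult.assoc)
  also have "(\<Sum>l\<in>UNIV. P$k$l * G l j) = G k j - (if k = j then 1 else 0)"
    using G_right[of k j] by linarith
  finally show ?thesis
    unfolding h_harmonic by (simp add: G_killed_def algebra_simps)
qed

lemma G_killed_left:
  assumes "j \<noteq> i"
  shows "(\<Sum>k\<in>UNIV. G_killed k m * P$k$j) = G_killed j m - (if m = j then 1 else 0)"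
proof -
  have "(\<Sum>k\<in>UNIV. G_killed k m * P$k$j) = (\<Sum>k\<in>UNIV. G m k * P$k$j) - h m * (\<Sum>k\<in>UNIV. G i k * P$k$j)"
    by (simp add: G_killed_def left_diff_distrib sum_subtractf sum_distrib_left mult.assoc)
  also have "(\<Sum>k\<in>UNIV. G m k * P$k$j) = G m j - (if m = j then 1 else 0)"
    using G_left[of m j] by linarith
  also have "(\<Sum>k\<in>UNIV. G i k * P$k$j) = G i j"
    using G_left[of i j] assms by simp
  finally show ?thesis by (simp add: G_killed_def)
qed

text \<open>The recursion has a positive defect only at \<open>i\<close>, where the function itself
  is 0.\<close>

lemma G_killed_nonneg: "0 \<le> G_killed j k"
proof (rule P_min_principle[where g="G_killed j"])
  show "0 \<le> G_killed j k \<or> (\<Sum>l\<in>UNIV. P$k$l * G_killed j l) \<le> G_killed j k" for k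
    unfolding G_killed_right by (cases "k = i") auto
qed

lemma G_killed_diag_ge_1: "j \<noteq> i \<Longrightarrow> 1 \<le> G_killed j j"
proof -
  assume "j \<noteq> i"
  moreover have "0 \<le> (\<Sum>l\<in>UNIV. P$j$l * G_killed j l)" by (intro sum_nonneg mult_nonneg_nonneg P_nonneg G_killed_nonneg)
  ultimately show ?thesis unfolding G_killed_right by simp
qed

text \<open>After twisting by \<open>beta\<close>, queue \<open>i\<close> is always busy and queue \<open>j\<close> has throughput
  \<open>throughput j * beta j\<close>.\<close>
definition throughput :: "'d \<Rightarrow> real" where "throughput j = nu j + (mu i / b - nu i) * (G i j / G i i)"

lemma throughput_nonneg: "0 \<le> throughput j"
proof -
  have "nu i \<le> mu i / b"
    using mult_right_mono[of "sqrt (nu i)" "sqrt (mu i)" "sqrt (nu i)"] sqrt_nu_less[of i] nu_pos[of i]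
    by (simp add: mu_div_b)
  then show ?thesis
    unfolding throughput_def using nu_pos[of j] G_nonneg[of i j] G_pos[of i] by (simp add: less_imp_le)
qed

text \<open>Minimality of the bottleneck enters here, as \<open>(?m - ?n) * R \<le> ?M - ?N\<close>.
  The bounds on \<open>X\<close> and \<open>Y\<close> each multiply a forward and a reversed
  comparison of \<open>G\<close> with its diagonal.\<close>

lemma throughput_stable:
  assumes "j \<noteq> i"
  shows "throughput j * beta j < mu j"
proof -
  let ?m = "sqrt (mu i)" and ?n = "sqrt (nu i)" and ?M = "sqrt (mu j)" and ?N = "sqrt (nu j)"
  define R where "R = sqrt (G j j / G i i)"
  define X where "X = G i j / G i i"
  define Y where "Y = G j i / G i i"
  have Gp: "0 < G i i" "0 < G j j" by (rule G_pos)+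
  have R: "0 \<le> R" "R\<^sup>2 = G j j / G i i" unfolding R_def using Gp by auto
  have n: "?n\<^sup>2 = nu i" "?N\<^sup>2 = nu j" "?m\<^sup>2 = mu i" "?M\<^sup>2 = mu j"
    using nu_pos[of i] nu_pos[of j] mu_pos[of i] mu_pos[of j] by (simp_all add: less_imp_le)
  have a: "(?m - ?n) * R \<le> ?M - ?N"
  proof (rule power2_le_imp_le)
    have "(?m - ?n)\<^sup>2 / G i i * G j j \<le> (?M - ?N)\<^sup>2"
      using bottleneck[of j] Gp by (simp add: pos_le_divide_eq)
    then show "((?m - ?n) * R)\<^sup>2 \<le> (?M - ?N)\<^sup>2" by (simp add: power_mult_distrib R)
  qed (use sqrt_nu_less[of j] in simp)
  have X: "?n * X \<le> ?N * R"
  proof (rule power2_le_imp_le)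
    have "(nu i * G i j) * G i j \<le> (nu j * G i i) * G j j"
      by (intro mult_mono nu_G_le_diag G_le_diag G_nonneg mult_nonneg_nonneg) (use nu_pos[of j] in simp)
    from divide_right_mono[OF this, of "(G i i)\<^sup>2"]
    show "(?n * X)\<^sup>2 \<le> (?N * R)\<^sup>2"
      unfolding power_mult_distrib n R X_def power_divide using Gp by (simp add: power2_eq_square mult.assoc)
  qed (use R sqrt_nu_less[of j] in simp)
  have Y: "?N * Y \<le> ?n * R"
  proof (rule power2_le_imp_le)
    have "(nu j * G j i) * G j i \<le> (nu i * G j j) * G i i"
      by (intro mult_mono nu_G_le_diag G_le_diag G_nonneg mult_nonneg_nonneg) (use nu_pos[of i] in simp)
    from divide_right_mono[OF this, of "(G i i)\<^sup>2"]
    show "(?N * Y)\<^sup>2 \<le> (?n * R)\<^sup>2"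
      unfolding power_mult_distrib n R Y_def power_divide using Gp by (simp add: power2_eq_square mult.assoc)
  qed (use R sqrt_nu_less[of i] in simp)
  \<comment> \<open>Strictness comes from the killed Green matrix: its diagonal entry at
    \<open>j\<close> is at least 1, hence positive.\<close>
  have XY: "X * Y < R\<^sup>2"
  proof -
    have "G j i * G i j < G j j * G i i"
      using G_killed_diag_ge_1[OF assms] Gp by (simp add: G_killed_def h_def field_simps)
    then show ?thesis unfolding R X_def Y_def using Gp by (simp add: field_simps)
  qed
  have "(?N\<^sup>2 + ?n * (?m - ?n) * X) * (1 + (?m - ?n) / ?n * Y) < ?M\<^sup>2"
    by (rule stability_arith) (use sqrt_nu_less[of i] sqrt_nu_less[of j] a X Y XY R in auto)
  moreover have "throughput j = ?N\<^sup>2 + ?n * (?m - ?n) * X"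
    unfolding throughput_def X_def mu_div_b using n(1,2) by (simp add: algebra_simps power2_eq_square)
  moreover have "beta j = 1 + (?m - ?n) / ?n * Y"
    using sqrt_nu_less[of i] by (simp add: beta_def h_def Y_def b_eq field_simps)
  ultimately show ?thesis using n by simp
qed

section \<open>The Doob transform of the network\<close>

abbreviation q :: "'d option \<Rightarrow> 'd option \<Rightarrow> real" where
  "q \<equiv> jackson_rates lam mu P"

definition beta_opt :: "'d option \<Rightarrow> real" where
  "beta_opt k = (case k of None \<Rightarrow> 1 | Some a \<Rightarrow> beta a)"

lemma beta_opt_simps [simp]: "beta_opt None = 1" "beta_opt (Some a) = beta a" by (simp_all add: beta_opt_def)

lemma beta_opt_pos: "0 < beta_opt k" using beta_pos by (cases k) auto

text \<open>Doob transform by \<open>F\<close>: on an enabled move the factor is the ratio of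
  \<open>F\<close> after and before the move, which by \<open>F_move\<close> does not depend on the
  state.\<close>

definition twisted :: "'d option \<Rightarrow> 'd option \<Rightarrow> real" where
  "twisted k l = q k l * beta_opt l / beta_opt k"

definition F :: "('d \<Rightarrow> nat) \<Rightarrow> real" where
  "F x = (\<Prod>a\<in>UNIV. beta a ^ x a)"

lemma q_nonneg: "0 \<le> q k l"
  by (cases k; cases l) (auto simp: lam_nonneg mu_pos P_nonneg p0_nonneg less_imp_le)

lemma twisted_nonneg: "0 \<le> twisted k l"
  using q_nonneg[of k l] beta_opt_pos[of k] beta_opt_pos[of l] by (simp add: twisted_def less_imp_le)

lemma F_pos: "0 < F x" unfolding F_def by (intro prod_pos) (simp add: beta_pos)

lemma F_fun_upd: "F (x(a := n)) * beta a ^ x a = F x * beta a ^ n"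
proof -
  have "F (x(a := n)) = beta a ^ n * (\<Prod>c\<in>UNIV - {a}. beta c ^ x c)"
    unfolding F_def by (subst prod.remove[of _ a]) auto
  moreover have "F x = beta a ^ x a * (\<Prod>c\<in>UNIV - {a}. beta c ^ x c)"
    unfolding F_def by (subst prod.remove[of _ a]) auto
  ultimately show ?thesis by simp
qed

lemma F_inc: "F (x(a := Suc (x a))) = F x * beta a"
  using F_fun_upd[of x a "Suc (x a)"] beta_pos[of a] by simp

lemma F_dec: "0 < x a \<Longrightarrow> F (x(a := x a - Suc 0)) = F x / beta a"
  using F_inc[of "x(a := x a - Suc 0)" a] beta_pos[of a] by (simp add: field_simps)

lemma F_move:
  assumes "enabled k x"
  shows "F (move k l x) = F x * (beta_opt l / beta_opt k)"
proof -
  define y where "y = (case k of None \<Rightarrow> x | Some a \<Rightarrow> x(a := x a - 1))"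
  have "F y = F x / beta_opt k" unfolding y_def using assms by (cases k) (auto simp: F_dec)
  moreover have "F (move k l x) = F y * beta_opt l"
    unfolding move_def y_def[symmetric] Let_def by (cases l) (auto simp: F_inc)
  ultimately show ?thesis by simp
qed

text \<open>Harmonicity of \<open>beta\<close> off \<open>i\<close> leaves only the arrival row and
  row \<open>i\<close>.\<close>

lemma row_excess:
  "(\<Sum>l\<in>UNIV. twisted k l - q k l) =
     (case k of None \<Rightarrow> (b - 1) * nu i / G i i
      | Some a \<Rightarrow> if a = i then - (mu i * (b - 1) / (b * G i i)) else 0)"
proof (cases k)
  case None
  have "(\<Sum>l\<in>UNIV. twisted None l - q None l) = (b - 1) * (\<Sum>l\<in>UNIV. lam l * h l)"
    by (simp add: sum_option_UNIV twisted_def beta_def algebra_simps sum_distrib_left sum.distrib sum_subtractf)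
  then show ?thesis using None by (simp add: sum_lam_h)
next
  case (Some a)
  have "(\<Sum>l\<in>UNIV. twisted (Some a) l - q (Some a) l)
      = mu a / beta a * (p0 P a + (\<Sum>l\<in>UNIV. P$a$l * beta l)) - mu a * (p0 P a + (\<Sum>l\<in>UNIV. P$a$l))"
    by (simp add: sum_option_UNIV twisted_def sum_subtractf sum_distrib_left distrib_left right_diff_distrib mult.assoc)
  also have "p0 P a + (\<Sum>l\<in>UNIV. P$a$l) = 1" by (simp add: p0_def)
  finally show ?thesis
    using Some beta_pos[of a] b_gt_1 unfolding beta_harmonic by (auto simp: right_diff_distrib)
qed

text \<open>While queue \<open>i\<close> is busy both nonzero rows are active, whatever the other
  queues do; this makes the potential constant.\<close>

lemma total_excess:
  assumes "0 < x i"
  shows "(\<Sum>k\<in>UNIV. \<Sum>l\<in>UNIV. if enabled k x then twisted k l - q k l else 0) = - decay"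
proof -
  have "(\<Sum>k\<in>UNIV. \<Sum>l\<in>UNIV. if enabled k x then twisted k l - q k l else 0)
      = (\<Sum>k\<in>UNIV. if enabled k x then (\<Sum>l\<in>UNIV. twisted k l - q k l) else 0)"
    by (intro sum.cong refl) auto
  also have "\<dots> = (b - 1) * nu i / G i i
      + (\<Sum>a\<in>UNIV. if 0 < x a then if a = i then - (mu i * (b - 1) / (b * G i i)) else 0 else 0)"
    unfolding row_excess by (simp add: sum_option_UNIV cong: if_cong)
  also have "(\<Sum>a\<in>UNIV. if 0 < x a then if a = i then - (mu i * (b - 1) / (b * G i i)) else 0 else 0)
      = (\<Sum>a\<in>UNIV. if a = i then - (mu i * (b - 1) / (b * G i i)) else 0)"
    using assms by (intro sum.cong) auto
  also have "(b - 1) * nu i / G i i + (\<Sum>a\<in>UNIV. if a = i then - (mu i * (b - 1) / (b * G i i)) else 0)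
      = (b - 1) * (nu i - mu i / b) / G i i"
    using b_gt_1 by (simp add: algebra_simps diff_divide_distrib add_divide_distrib)
  also have "(b - 1) * (nu i - mu i / b) = - (sqrt (mu i) - sqrt (nu i))\<^sup>2"
  proof -
    define m where "m = sqrt (mu i)"
    define n where "n = sqrt (nu i)"
    have n: "0 < n" "nu i = n * n" using sqrt_nu_less[of i] nu_pos[of i] by (auto simp: n_def)
    show ?thesis
      unfolding mu_div_b unfolding b_eq m_def[symmetric] n_def[symmetric] n(2)
      using n(1) by (simp add: field_simps power2_eq_square)
  qed
  finally show ?thesis by (simp add: decay_def)
qed

text \<open>Each increment of \<open>F * \<psi>\<close> splits into \<open>F x\<close> times a
  twisted increment of \<open>\<psi>\<close> and \<open>F x * \<psi> x\<close> times the excess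
  rate.\<close>

lemma gen_twist:
  assumes "0 < x i"
  shows "gen q (\<lambda>z. F z * \<psi> z) x = F x * (gen twisted \<psi> x - decay * \<psi> x)"
proof -
  have "gen q (\<lambda>z. F z * \<psi> z) x = (\<Sum>k\<in>UNIV. \<Sum>l\<in>UNIV. F x * (if enabled k x then twisted k l * (\<psi> (move k l x) - \<psi> x) else 0)
     + F x * \<psi> x * (if enabled k x then twisted k l - q k l else 0))"
    unfolding gen_def by (intro sum.cong refl) (auto simp: F_move twisted_def algebra_simps diff_divide_distrib)
  also have "\<dots> = F x * gen twisted \<psi> x + F x * \<psi> x * (\<Sum>k\<in>UNIV. \<Sum>l\<in>UNIV. if enabled k x then twisted k l - q k l else 0)"
    unfolding gen_def sum_distrib_left sum.distrib ..
  finally show ?thesis unfolding total_excess[of x, OF assms] by (simp add: algebra_simps)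
qed

text \<open>Weights are written as \<open>V k / beta k\<close> because the denominator cancels the
  factor \<open>beta\<close> in the twisted rates, leaving \<open>P\<close> applied to
  \<open>V\<close> and to \<open>beta\<close>.\<close>

lemma drift_twisted:
  "drift twisted (\<lambda>k. V k / beta k) x = (\<Sum>l\<in>UNIV. lam l * V l)
     + (\<Sum>k\<in>UNIV. if 0 < x k then mu k / beta k *
          ((\<Sum>l\<in>UNIV. P$k$l * V l) - V k / beta k * (p0 P k + (\<Sum>l\<in>UNIV. P$k$l * beta l))) else 0)"
proof -
  have nz: "beta k \<noteq> 0" for k using beta_pos[of k] by simp
  let ?v = "wt (\<lambda>k. V k / beta k)"
  have "(\<Sum>l\<in>UNIV. if enabled None x then twisted None l * (?v l - ?v None) else 0) = (\<Sum>l\<in>UNIV. lam l * V l)"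
    by (simp add: sum_option_UNIV twisted_def nz)
  moreover have "(\<Sum>l\<in>UNIV. if enabled (Some k) x then twisted (Some k) l * (?v l - ?v (Some k)) else 0)
     = (if 0 < x k then mu k / beta k *
          ((\<Sum>l\<in>UNIV. P$k$l * V l) - V k / beta k * (p0 P k + (\<Sum>l\<in>UNIV. P$k$l * beta l))) else 0)" for k
  proof -
    have "(\<Sum>l\<in>UNIV. twisted (Some k) l * (?v l - ?v (Some k)))
      = - (mu k * p0 P k / beta k * (V k / beta k))
        + (\<Sum>l\<in>UNIV. mu k / beta k * (P$k$l * V l) - mu k / beta k * (V k / beta k) * (P$k$l * beta l))"
      using nz by (simp add: sum_option_UNIV twisted_def) (intro sum.cong refl, simp add: field_simps)
    also have "\<dots> = mu k / beta k *
          ((\<Sum>l\<in>UNIV. P$k$l * V l) - V k / beta k * (p0 P k + (\<Sum>l\<in>UNIV. P$k$l * beta l)))"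
      unfolding sum_subtractf sum_distrib_left[symmetric] by (simp add: algebra_simps)
    finally show ?thesis by simp
  qed
  ultimately show ?thesis
    unfolding drift_def sum_option_UNIV[where f="\<lambda>k. \<Sum>l\<in>UNIV. if enabled k x then twisted k l * (?v l - ?v k) else 0"]
    by simp
qed

text \<open>The probability that a customer at \<open>k\<close> ever visits \<open>i\<close> under
  the twisted routing.\<close>

definition c :: "'d \<Rightarrow> real" where "c k = (b * h k) / beta k"

lemma c_bounds: "0 \<le> c k" "c k \<le> 1" "c i = 1"
proof -
  show "0 \<le> c k" using b_gt_1 h_bounds[of k] beta_pos[of k] by (simp add: c_def)
  have "b * h k \<le> beta k" using h_bounds[of k] by (simp add: beta_def algebra_simps)
  then show "c k \<le> 1" using beta_pos[of k] by (simp add: c_def)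
  show "c i = 1" using b_gt_1 by (simp add: c_def)
qed

text \<open>Nodes other than \<open>i\<close> contribute nothing by harmonicity. The arrival term
  \<open>b * nu i / G i i\<close> balances the loss \<open>mu i / b / G i i\<close> at
  \<open>i\<close> by the choice of \<open>b\<close>.\<close>

lemma drift_c:
  assumes "0 < x i"
  shows "drift twisted c x = 0"
proof -
  have eq: "mu k / beta k * ((\<Sum>l\<in>UNIV. P$k$l * (b * h l)) - (b * h k) / beta k * (p0 P k + (\<Sum>l\<in>UNIV. P$k$l * beta l)))
      = (if k = i then - (mu i / b / G i i) else 0)" for k
  proof -
    have eq: "(\<Sum>l\<in>UNIV. P$k$l * (b * h l)) = b * (\<Sum>l\<in>UNIV. P$k$l * h l)"
      by (simp add: sum_distrib_left mult.left_commute)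
    show ?thesis
      unfolding eq h_harmonic beta_harmonic using beta_pos[of k] b_gt_1 G_pos[of i]
      by (auto simp: field_simps)
  qed
  have eq2: "(\<Sum>l\<in>UNIV. lam l * (b * h l)) = b * (nu i / G i i)"
    unfolding sum_lam_h[symmetric] by (simp add: sum_distrib_left mult.left_commute)
  have c: "(\<lambda>k. b * h k / beta k) = c" by (simp add: c_def fun_eq_iff)
  have eq3: "(\<Sum>k\<in>UNIV. if 0 < x k then (if k = i then - (mu i / b / G i i) else 0) else 0) = - (mu i / b / G i i)"
  proof -
    have "(\<Sum>k\<in>UNIV. if 0 < x k then (if k = i then - (mu i / b / G i i) else 0) else 0)
      = (\<Sum>k\<in>UNIV. if k = i then - (mu i / b / G i i) else 0)"
      using assms by (intro sum.cong) auto
    then show ?thesis by simp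
  qed
  have "drift twisted c x = b * (nu i / G i i) - mu i / b / G i i"
    using drift_twisted[of "\<lambda>k. b * h k" x] unfolding eq eq2 eq3 c by simp
  also have "mu i / b = b * nu i"
    unfolding mu_div_b b_eq using sqrt_nu_less[of i] nu_pos[of i] by (simp add: field_simps)
  finally show ?thesis by simp
qed

text \<open>Some arrival stream can reach \<open>i\<close>, because \<open>sum_lam_h\<close> is
  positive; the martingale is therefore not degenerate.\<close>

lemma c_moves: "0 < (\<Sum>l\<in>UNIV. twisted None l * (wt c l)\<^sup>2)"
proof -
  have "0 < (\<Sum>l\<in>UNIV. lam l * h l)" unfolding sum_lam_h using nu_pos[of i] G_pos[of i] by simp
  then obtain l where "0 < lam l * h l" using sum_pos_exists by blast
  then have l: "0 < lam l" "0 < h l" using lam_nonneg[of l] h_bounds[of l] by (auto simp: zero_less_mult_iff)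
  have "0 < twisted None (Some l) * (wt c (Some l))\<^sup>2"
    using l beta_pos[of l] b_gt_1 by (simp add: twisted_def c_def)
  also have "\<dots> \<le> (\<Sum>l\<in>UNIV. twisted None l * (wt c l)\<^sup>2)"
    by (intro member_le_sum) (auto simp: twisted_nonneg)
  finally show ?thesis .
qed

section \<open>Workloads of the other queues\<close>

definition visits :: "'d \<Rightarrow> real" where "visits j = (\<Sum>m\<in>UNIV. G_killed j m)"
text \<open>Up to the factor \<open>beta j\<close>, the expected number of visits to
  \<open>j\<close>, before any visit to \<open>i\<close>, by the customers present, under the
  twisted routing; a customer now at \<open>j\<close> counts as visiting.\<close>

definition workload :: "'d \<Rightarrow> ('d \<Rightarrow> nat) \<Rightarrow> real" where "workload j x = lin (\<lambda>k. G_killed j k / beta k) x"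

text \<open>Only three terms survive: arrivals, the constant feed from the busy queue
  \<open>i\<close>, and service at \<open>j\<close> when \<open>j\<close> is busy. By
  \<open>throughput_stable\<close> the drift is negative in the last case.\<close>

lemma drift_workload:
  assumes "0 < x i" "j \<noteq> i"
  shows "drift twisted (\<lambda>k. G_killed j k / beta k) x = throughput j - (if 0 < x j then mu j / beta j else 0)"
proof -
  have eq: "mu k / beta k * ((\<Sum>l\<in>UNIV. P$k$l * G_killed j l) - G_killed j k / beta k * (p0 P k + (\<Sum>l\<in>UNIV. P$k$l * beta l)))
      = (if k = i then mu i / b * (G i j / G i i) else 0) - (if k = j then mu j / beta j else 0)" for k
    unfolding G_killed_right beta_harmonic using assms beta_pos[of k] by (auto simp: field_simps)
  have "drift twisted (\<lambda>k. G_killed j k / beta k) x = (\<Sum>l\<in>UNIV. lam l * G_killed j l)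
    + (\<Sum>k\<in>UNIV. if 0 < x k then (if k = i then mu i / b * (G i j / G i i) else 0) - (if k = j then mu j / beta j else 0) else 0)"
    unfolding drift_twisted eq ..
  also have "(\<Sum>k\<in>UNIV. if 0 < x k then (if k = i then mu i / b * (G i j / G i i) else 0) - (if k = j then mu j / beta j else 0) else 0)
     = (\<Sum>k\<in>UNIV. (if k = i then mu i / b * (G i j / G i i) else 0) - (if k = j then (if 0 < x j then mu j / beta j else 0) else 0))"
    using assms by (intro sum.cong) auto
  also have "\<dots> = mu i / b * (G i j / G i i) - (if 0 < x j then mu j / beta j else 0)"
    by (simp add: sum_subtractf)
  also have "(\<Sum>l\<in>UNIV. lam l * G_killed j l) = nu j - nu i * (G i j / G i i)"
  proof -
    have "(\<Sum>l\<in>UNIV. lam l * G_killed j l) = (\<Sum>l\<in>UNIV. lam l * G l j) - (\<Sum>l\<in>UNIV. lam l * h l) * G i j"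
      by (simp add: G_killed_def right_diff_distrib sum_subtractf sum_distrib_right mult.assoc)
    then show ?thesis unfolding sum_lam_h nu_eq[of j, symmetric] by simp
  qed
  finally show ?thesis by (simp add: throughput_def algebra_simps)
qed

lemma visits_ge_1: "j \<noteq> i \<Longrightarrow> 1 \<le> visits j"
proof -
  assume "j \<noteq> i"
  then have "1 \<le> G_killed j j" by (rule G_killed_diag_ge_1)
  also have "\<dots> \<le> visits j" unfolding visits_def by (intro member_le_sum) (auto simp: G_killed_nonneg)
  finally show ?thesis .
qed

lemma visits_i [simp]: "visits i = 0" by (simp add: visits_def)
lemma workload_i [simp]: "workload i x = 0" by (simp add: workload_def lin_def)

text \<open>The surplus 1 over the inflow is the source of the factor \<open>1 - 1 / Om\<close> in
  \<open>workload_idle\<close>.\<close>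

lemma visits_rec: "j \<noteq> i \<Longrightarrow> visits j = 1 + (\<Sum>k\<in>UNIV. visits k * P$k$j)"
proof -
  assume j: "j \<noteq> i"
  have "(\<Sum>k\<in>UNIV. visits k * P$k$j) = (\<Sum>m\<in>UNIV. \<Sum>k\<in>UNIV. G_killed k m * P$k$j)"
    unfolding visits_def sum_distrib_right by (rule sum.swap)
  also have "\<dots> = visits j - 1" unfolding G_killed_left[OF j] by (simp add: sum_subtractf visits_def)
  finally show ?thesis by simp
qed

lemma workload_rec: "j \<noteq> i \<Longrightarrow> workload j x = real (x j) / beta j + (\<Sum>k\<in>UNIV. workload k x * P$k$j)"
proof -
  assume j: "j \<noteq> i"
  have "(\<Sum>k\<in>UNIV. workload k x * P$k$j) = (\<Sum>m\<in>UNIV. (\<Sum>k\<in>UNIV. G_killed k m * P$k$j) / beta m * real (x m))"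
    unfolding workload_def lin_def sum_distrib_right sum_divide_distrib
    by (subst sum.swap) (intro sum.cong refl, simp add: mult.commute mult.left_commute)
  also have "\<dots> = workload j x - (\<Sum>m\<in>UNIV. if m = j then real (x j) / beta j else 0)"
    unfolding G_killed_left[OF j] workload_def lin_def sum_subtractf[symmetric]
    by (intro sum.cong refl) (auto simp: diff_divide_distrib algebra_simps)
  finally show ?thesis by simp
qed

lemma workload_nonneg: "0 \<le> workload j x"
  unfolding workload_def lin_def by (intro sum_nonneg mult_nonneg_nonneg divide_nonneg_pos G_killed_nonneg beta_pos) simp

text \<open>An idle queue never attains the maximum of the normalised workloads \<open>workload k x / visits k\<close>, by a
  uniform factor; this makes the sum of their exponentials a Lyapunov function.\<close>
lemma workload_idle:
  assumes "j \<noteq> i" "x j = 0" "0 \<le> \<tau>" "\<And>k. k \<noteq> i \<Longrightarrow> workload k x / visits k \<le> \<tau>" "\<And>k. visits k \<le> Om"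
  shows "workload j x / visits j \<le> (1 - 1 / Om) * \<tau>"
proof -
  have zk: "workload k x \<le> \<tau> * visits k" for k
    using assms(4)[of k] visits_ge_1[of k] by (cases "k = i") (auto simp: pos_divide_le_eq)
  have "workload j x = (\<Sum>k\<in>UNIV. workload k x * P$k$j)" using workload_rec[OF assms(1), of x] assms(2) by simp
  also have "\<dots> \<le> (\<Sum>k\<in>UNIV. \<tau> * visits k * P$k$j)" by (intro sum_mono mult_right_mono zk P_nonneg)
  also have "\<dots> = \<tau> * (visits j - 1)"
    using visits_rec[OF assms(1)] by (simp add: sum_distrib_left mult.assoc)
  finally have "workload j x / visits j \<le> \<tau> * (visits j - 1) / visits j"
    using visits_ge_1[OF assms(1)] by (intro divide_right_mono) auto
  also have "\<dots> = (1 - 1 / visits j) * \<tau>" using visits_ge_1[OF assms(1)] by (simp add: field_simps)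
  also have "\<dots> \<le> (1 - 1 / Om) * \<tau>"
    using visits_ge_1[OF assms(1)] assms(5)[of j] assms(3)
    by (intro mult_right_mono diff_left_mono divide_left_mono) auto
  finally show ?thesis .
qed


section \<open>The Lyapunov function of the twisted network\<close>

definition workload_wt :: "'d \<Rightarrow> 'd \<Rightarrow> real" where "workload_wt j k = G_killed j k / beta k / visits j"

lemma lin_workload_wt: "lin (workload_wt j) x = workload j x / visits j"
  unfolding lin_def workload_def workload_wt_def by (simp add: sum_divide_distrib)

lemma drift_workload_wt:
  assumes "0 < x i" "j \<noteq> i"
  shows "drift twisted (workload_wt j) x = (throughput j - (if 0 < x j then mu j / beta j else 0)) / visits j"
proof -
  have wt: "wt (workload_wt j) l = wt (\<lambda>k. G_killed j k / beta k) l / visits j" for l by (cases l) (simp_all add: workload_wt_def)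
  have "drift twisted (workload_wt j) x = drift twisted (\<lambda>k. G_killed j k / beta k) x / visits j"
    unfolding drift_def sum_divide_distrib wt by (intro sum.cong refl) (auto simp: diff_divide_distrib right_diff_distrib)
  then show ?thesis using drift_workload[of x j] assms by simp
qed

text \<open>For small \<open>a\<close> the exponential of a busy queue's workload decays at rate
  \<open>a * \<eta>\<close>. That of an idle queue may grow, but it is at most
  \<open>exp (\<rho> * (a * \<tau>))\<close> with \<open>\<rho> < 1\<close>, which the decay of the
  whole sum absorbs.\<close>

lemma lyapunov:
  obtains a K \<kappa> where "0 < a" "0 < K" "0 < \<kappa>"
    "\<And>x. 0 < x i \<Longrightarrow> gen twisted (\<lambda>x. \<Sum>j\<in>UNIV - {i}. exp (a * lin (workload_wt j) x)) x
       \<le> K - \<kappa> * (\<Sum>j\<in>UNIV - {i}. exp (a * lin (workload_wt j) x))"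
proof -
  define J where "J = UNIV - {i}"
  define Q where "Q = (\<Sum>k\<in>UNIV. \<Sum>l\<in>UNIV. twisted k l)"
  have Q: "0 \<le> Q" unfolding Q_def by (intro sum_nonneg twisted_nonneg)
  define M where "M = 1 + (\<Sum>j\<in>UNIV. \<Sum>k\<in>UNIV. \<bar>workload_wt j k\<bar>)"
  have uM: "\<bar>wt (workload_wt j) l\<bar> \<le> M - 1" for j l
  proof (cases l)
    case None
    then show ?thesis unfolding M_def by (simp add: sum_nonneg)
  next
    case (Some k)
    have "\<bar>workload_wt j k\<bar> \<le> (\<Sum>k\<in>UNIV. \<bar>workload_wt j k\<bar>)" by (intro member_le_sum) auto
    also have "\<dots> \<le> (\<Sum>j\<in>UNIV. \<Sum>k\<in>UNIV. \<bar>workload_wt j k\<bar>)" by (intro member_le_sum) (auto intro: sum_nonneg)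
    finally show ?thesis using Some by (simp add: M_def)
  qed
  have M1: "1 \<le> M" unfolding M_def by (simp add: sum_nonneg)
  have M2: "\<bar>wt (workload_wt j) l - wt (workload_wt j) k\<bar> \<le> 2 * M" for j k l
    using uM[of j l] uM[of j k] by linarith
  define gap where "gap j = (mu j / beta j - throughput j) / visits j" for j
  have gap: "0 < gap j" if "j \<in> J" for j
  proof -
    have "throughput j < mu j / beta j" using throughput_stable[of j] that beta_pos[of j] by (simp add: J_def pos_less_divide_eq)
    then show ?thesis using visits_ge_1[of j] that by (simp add: gap_def J_def)
  qed
  \<comment> \<open>Inserting 1 covers an empty \<open>J\<close>. Of the two \<open>\<eta>\<close>
    inside each gap, one pays for the second-order term and one remains as decay.\<close>
  define \<eta> where "\<eta> = Min (insert 1 (gap ` J)) / 2"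
  have "0 < Min (insert 1 (gap ` J))" using gap by (subst Min_gr_iff) (auto simp: J_def)
  then have \<eta>: "0 < \<eta>" by (simp add: \<eta>_def)
  have gap_ge: "2 * \<eta> \<le> gap j" if "j \<in> J" for j
    unfolding \<eta>_def using that by (auto simp: J_def)
  define C where "C = (\<Sum>j\<in>J. throughput j / visits j)"
  have wC: "throughput j / visits j \<le> C" if "j \<in> J" for j
    unfolding C_def using that by (intro member_le_sum) (auto simp: J_def throughput_nonneg intro!: divide_nonneg_pos less_le_trans[OF zero_less_one visits_ge_1])
  have C: "0 \<le> C"
    unfolding C_def by (intro sum_nonneg) (auto simp: J_def throughput_nonneg intro!: divide_nonneg_pos less_le_trans[OF zero_less_one visits_ge_1])
  \<comment> \<open>The first bound keeps exponents in the range of \<open>exp_le_quadratic\<close>;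
    the second keeps the second-order term below \<open>\<eta>\<close>.\<close>
  define a where "a = min (1 / (2 * M)) (\<eta> / ((2 * M)\<^sup>2 * Q + 1))"
  have den: "0 < (2 * M)\<^sup>2 * Q + 1" using Q by (simp add: add_nonneg_pos)
  have a: "0 < a" unfolding a_def using M1 \<eta> den by simp
  have aM: "a * (2 * M) \<le> 1"
    using M1 unfolding a_def by (subst pos_le_divide_eq[symmetric]) auto
  have "a * ((2 * M)\<^sup>2 * Q + 1) \<le> \<eta>"
    using den unfolding a_def by (subst pos_le_divide_eq[symmetric]) auto
  then have aQ: "a * ((2 * M)\<^sup>2 * Q) \<le> \<eta>" using a by (simp add: distrib_left)
  define E where "E j x = exp (a * lin (workload_wt j) x)" for j x
  have E0: "0 < E j x" for j x by (simp add: E_def)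
  have gen_E: "gen twisted (E j) x \<le> E j x * (a * (drift twisted (workload_wt j) x + \<eta>))" for j x
  proof -
    have "gen twisted (E j) x \<le> (E j x * a) * drift twisted (workload_wt j) x + (E j x * a\<^sup>2) * qvar twisted (workload_wt j) x"
    proof (rule gen_le_of_quadratic[OF twisted_nonneg])
      fix k l assume en: "enabled k x"
      define d where "d = a * (wt (workload_wt j) l - wt (workload_wt j) k)"
      have "\<bar>d\<bar> \<le> a * (2 * M)" unfolding d_def abs_mult using a M2[of j l k] by (simp add: mult_left_mono)
      then have "\<bar>d\<bar> \<le> 1" using aM by simp
      then have "E j x * (exp d - 1) \<le> E j x * (d + d\<^sup>2)"
        using exp_le_quadratic[of d] E0[of j x] by (intro mult_left_mono) auto
      moreover have "E j (move k l x) = E j x * exp d"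
        unfolding E_def d_def lin_move[OF en] by (simp add: exp_add[symmetric] algebra_simps)
      ultimately show "E j (move k l x) - E j x
          \<le> E j x * a * (wt (workload_wt j) l - wt (workload_wt j) k) + E j x * a\<^sup>2 * (wt (workload_wt j) l - wt (workload_wt j) k)\<^sup>2"
        unfolding d_def power_mult_distrib by (simp add: algebra_simps)
    qed
    also have "\<dots> \<le> (E j x * a) * drift twisted (workload_wt j) x + (E j x * a\<^sup>2) * ((2 * M)\<^sup>2 * Q)"
      unfolding Q_def using E0[of j x]
      by (intro add_left_mono mult_left_mono qvar_le twisted_nonneg M2) auto
    also have "\<dots> = E j x * a * (drift twisted (workload_wt j) x + a * ((2 * M)\<^sup>2 * Q))"
      by (simp add: algebra_simps power2_eq_square)
    also have "\<dots> \<le> E j x * a * (drift twisted (workload_wt j) x + \<eta>)"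
      using aQ E0[of j x] a by (intro mult_left_mono) auto
    finally show ?thesis by (simp add: mult.assoc)
  qed
  define Om where "Om = 1 + (\<Sum>j\<in>UNIV. visits j)"
  have om0: "0 \<le> visits j" for j unfolding visits_def by (intro sum_nonneg G_killed_nonneg)
  have om_le: "visits j \<le> Om" for j
    using member_le_sum[of j UNIV visits] om0 by (simp add: Om_def)
  have Om: "0 < Om" unfolding Om_def using om0 by (simp add: add_pos_nonneg sum_nonneg)
  define \<rho> where "\<rho> = 1 - 1 / Om"
  \<comment> \<open>All idle contributions together may use up half of the decay rate.\<close>
  obtain K0 where K0: "0 < K0" "\<And>s. 0 \<le> s \<Longrightarrow> real (card J) * (C + 2 * \<eta>) * exp (\<rho> * s) \<le> \<eta> / 2 * exp s + K0"
    using exp_absorb_smaller_rate[of \<rho> "real (card J) * (C + 2 * \<eta>)" "\<eta> / 2"] Om C \<eta> by (auto simp: \<rho>_def)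
  define W where "W x = (\<Sum>j\<in>J. E j x)" for x
  have main: "gen twisted W x \<le> a * (\<eta> / 2 + K0) - a * \<eta> / 2 * W x" if xi: "0 < x i" for x
  proof -
    \<comment> \<open>Inserting 0 makes the maximum exist for empty \<open>J\<close> and keeps
      \<open>\<tau>\<close> nonnegative.\<close>
    define \<tau> where "\<tau> = Max (insert 0 ((\<lambda>k. lin (workload_wt k) x) ` J))"
    have fin: "finite (insert 0 ((\<lambda>k. lin (workload_wt k) x) ` J))" by (simp add: J_def)
    have \<tau>: "0 \<le> \<tau>" "\<And>k. k \<in> J \<Longrightarrow> lin (workload_wt k) x \<le> \<tau>"
      unfolding \<tau>_def using fin by (auto intro: Max_ge)
    have exp\<tau>: "exp (a * \<tau>) \<le> W x + 1"
    proof -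
      have "\<tau> \<in> insert 0 ((\<lambda>k. lin (workload_wt k) x) ` J)" unfolding \<tau>_def using fin by (intro Max_in) auto
      then consider "\<tau> = 0" | k where "k \<in> J" "\<tau> = lin (workload_wt k) x" by auto
      then show ?thesis
      proof cases
        case 1
        then show ?thesis using E0 by (simp add: W_def sum_nonneg less_imp_le)
      next
        case 2
        have "E k x \<le> W x" unfolding W_def using 2(1) E0 by (intro member_le_sum) (auto simp: J_def less_imp_le)
        then show ?thesis using 2 by (simp add: E_def)
      qed
    qed
    have each: "gen twisted (E j) x \<le> - (a * \<eta>) * E j x + a * ((C + 2 * \<eta>) * exp (\<rho> * (a * \<tau>)))" if j: "j \<in> J" for j
    proof (cases "0 < x j")
      case True
      have "drift twisted (workload_wt j) x + \<eta> \<le> - \<eta>"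
        using gap_ge[OF j] drift_workload_wt[of x j] xi j True by (simp add: J_def gap_def diff_divide_distrib)
      then have "E j x * (a * (drift twisted (workload_wt j) x + \<eta>)) \<le> E j x * (a * (- \<eta>))"
        using E0[of j x] a by (intro mult_left_mono) auto
      then have "gen twisted (E j) x \<le> - (a * \<eta>) * E j x" using gen_E[of j x] by (simp add: algebra_simps)
      moreover have "0 \<le> a * ((C + 2 * \<eta>) * exp (\<rho> * (a * \<tau>)))" using a C \<eta> by simp
      ultimately show ?thesis by linarith
    next
      case False
      have "workload j x / visits j \<le> (1 - 1 / Om) * \<tau>"
        by (rule workload_idle) (use j False \<tau> om_le in \<open>auto simp: J_def lin_workload_wt[symmetric]\<close>)
      then have "lin (workload_wt j) x \<le> \<rho> * \<tau>" by (simp add: lin_workload_wt \<rho>_def)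
      then have "a * lin (workload_wt j) x \<le> a * (\<rho> * \<tau>)" using a by (intro mult_left_mono) auto
      then have Ej: "E j x \<le> exp (\<rho> * (a * \<tau>))" by (simp add: E_def mult.left_commute)
      have "drift twisted (workload_wt j) x \<le> C" using drift_workload_wt[of x j] xi j False wC[OF j] by (simp add: J_def)
      then have "E j x * (a * (drift twisted (workload_wt j) x + \<eta>)) \<le> E j x * (a * (C + \<eta>))"
        using E0[of j x] a by (intro mult_left_mono) auto
      \<comment> \<open>Adding and subtracting \<open>\<eta>\<close> gives idle queues the same
        leading decay term as busy ones.\<close>
      also have "\<dots> = - (a * \<eta>) * E j x + a * ((C + 2 * \<eta>) * E j x)" by (simp add: algebra_simps)
      also have "\<dots> \<le> - (a * \<eta>) * E j x + a * ((C + 2 * \<eta>) * exp (\<rho> * (a * \<tau>)))"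
        using Ej a C \<eta> by (intro add_left_mono mult_left_mono) auto
      finally show ?thesis using gen_E[of j x] by linarith
    qed
    have "gen twisted W x = (\<Sum>j\<in>J. gen twisted (E j) x)" unfolding W_def by (rule gen_sum)
    also have "\<dots> \<le> (\<Sum>j\<in>J. - (a * \<eta>) * E j x + a * ((C + 2 * \<eta>) * exp (\<rho> * (a * \<tau>))))"
      by (intro sum_mono each)
    also have "\<dots> = - (a * \<eta>) * W x + a * (real (card J) * (C + 2 * \<eta>) * exp (\<rho> * (a * \<tau>)))"
      by (simp add: W_def sum.distrib sum_subtractf sum_distrib_left sum_negf mult.assoc mult.left_commute)
    also have "\<dots> \<le> - (a * \<eta>) * W x + a * (\<eta> / 2 * exp (a * \<tau>) + K0)"
      using a K0(2)[of "a * \<tau>"] \<tau>(1) by (intro add_left_mono mult_left_mono) auto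
    also have "\<dots> \<le> - (a * \<eta>) * W x + a * (\<eta> / 2 * (W x + 1) + K0)"
      using a \<eta> exp\<tau> by (intro add_left_mono mult_left_mono add_right_mono) auto
    also have "\<dots> = a * (\<eta> / 2 + K0) - a * \<eta> / 2 * W x" by (simp add: field_simps)
    finally show ?thesis .
  qed
  have W_eq: "W = (\<lambda>x. \<Sum>j\<in>UNIV - {i}. exp (a * lin (workload_wt j) x))"
    by (simp add: fun_eq_iff W_def E_def J_def)
  show thesis
    by (rule that[of a "a * (\<eta> / 2 + K0)" "a * \<eta> / 2"])
      (use a \<eta> K0(1) main[unfolded W_eq] in \<open>auto intro: add_pos_pos\<close>)
qed

text \<open>Iterating the taboo kernel needs \<open>s \<le> unif_const lam mu\<close>; the extra 1
  leaves room for \<open>s = decay + \<epsilon>\<close> with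
  \<open>\<epsilon> \<le> 1\<close>.\<close>

lemma decay_le: "decay + 1 \<le> unif_const lam mu"
proof -
  have "(sqrt (mu i) - sqrt (nu i))\<^sup>2 \<le> (sqrt (mu i))\<^sup>2"
    using sqrt_nu_less[of i] by (intro power_mono) auto
  then have "(sqrt (mu i) - sqrt (nu i))\<^sup>2 \<le> mu i" using mu_pos[of i] by simp
  moreover have "decay \<le> (sqrt (mu i) - sqrt (nu i))\<^sup>2 / 1"
    unfolding decay_def using G_diag_ge_1[of i] by (intro divide_left_mono) auto
  moreover have "mu i \<le> (\<Sum>k\<in>UNIV. mu k)" using mu_pos by (intro member_le_sum) (auto simp: less_imp_le)
  moreover have "0 \<le> (\<Sum>k\<in>UNIV. lam k)" by (intro sum_nonneg lam_nonneg)
  ultimately show "decay + 1 \<le> unif_const lam mu" unfolding unif_const_def by simp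
qed

text \<open>Multiplying the twisted test function by \<open>F\<close> undoes the Doob transform and
  turns \<open>- \<epsilon>\<close> into \<open>- (decay + \<epsilon>)\<close>.\<close>

lemma test_function:
  assumes E: "finite E" and eps: "0 < \<epsilon>"
  shows "\<exists>f. finite {z. f z \<noteq> 0} \<and> (\<forall>z. 0 \<le> f z) \<and> (\<forall>z\<in>E. f z = 0) \<and> (\<exists>z. f z \<noteq> 0)
        \<and> (\<forall>x. - (decay + \<epsilon>) * f x \<le> gen q f x)"
proof -
  obtain a K \<kappa> where a: "0 < a" and K: "0 < K" "0 < \<kappa>"
    and lyap: "\<And>x. 0 < x i \<Longrightarrow> gen twisted (\<lambda>x. \<Sum>j\<in>UNIV - {i}. exp (a * lin (workload_wt j) x)) x
       \<le> K - \<kappa> * (\<Sum>j\<in>UNIV - {i}. exp (a * lin (workload_wt j) x))"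
    using lyapunov by blast
  define W where "W x = (\<Sum>j\<in>UNIV - {i}. exp (a * lin (workload_wt j) x))" for x
  \<comment> \<open>Requiring \<open>N \<le> real (x i)\<close> keeps the support off
    \<open>E\<close>, and the successor keeps queue \<open>i\<close> busy there, as
    \<open>gen_twist\<close> requires.\<close>
  define N where "N = real (Suc (\<Sum>e\<in>E. e i))"
  have N: "real (e i) < N" if "e \<in> E" for e
    using member_le_sum[of e E "\<lambda>e. e i"] E that unfolding N_def of_nat_less_iff by (simp add: less_Suc_eq_le)
  have "\<exists>\<psi>. finite {x. \<psi> x \<noteq> 0} \<and> (\<forall>x. 0 \<le> \<psi> x) \<and> (\<exists>x. \<psi> x \<noteq> 0) \<and> (\<forall>x. \<psi> x \<noteq> 0 \<longrightarrow> N \<le> real (x i))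
    \<and> (\<forall>x. 0 < x i \<longrightarrow> \<psi> x \<noteq> 0 \<longrightarrow> - \<epsilon> * \<psi> x \<le> gen twisted \<psi> x)"
  proof (rule gen_test_function[where c=c and W=W and K=K and \<kappa>=\<kappa> and ?W0.0="real CARD('d)"])
    show "0 \<le> W x" for x unfolding W_def by (simp add: sum_nonneg)
    show "W ((\<lambda>_. 0)(i := n)) \<le> real CARD('d)" for n
    proof -
      have "lin (workload_wt j) ((\<lambda>_. 0)(i := n)) = 0" for j
        unfolding lin_def by (intro sum.neutral) (auto simp: workload_wt_def)
      then have "W ((\<lambda>_. 0)(i := n)) = real (card (UNIV - {i}))" by (simp add: W_def)
      also have "\<dots> \<le> real CARD('d)" by (intro of_nat_mono card_mono) auto
      finally show ?thesis .
    qed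
    show "\<exists>Y. \<forall>x k. W x \<le> B \<longrightarrow> k \<noteq> i \<longrightarrow> real (x k) \<le> Y" for B
    proof (intro exI allI impI)
      fix x k assume WB: "W x \<le> B" and k: "k \<noteq> i"
      have visits: "1 \<le> visits k" using k by (rule visits_ge_1)
      \<comment> \<open>\<open>x k / beta k\<close> is one of the nonnegative parts of the workload,
        and the workload is controlled by \<open>W\<close> through
        \<open>y \<le> exp y\<close>.\<close>
      have "workload k x = real (x k) / beta k + (\<Sum>l\<in>UNIV. workload l x * P$l$k)" using k by (rule workload_rec)
      moreover have "0 \<le> (\<Sum>l\<in>UNIV. workload l x * P$l$k)" by (intro sum_nonneg mult_nonneg_nonneg workload_nonneg P_nonneg)
      ultimately have "real (x k) \<le> beta k * workload k x" using beta_pos[of k] by (simp add: pos_divide_le_eq[symmetric] mult.commute field_simps)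
      also have "workload k x = visits k * lin (workload_wt k) x" using visits by (simp add: lin_workload_wt)
      also have "lin (workload_wt k) x \<le> B / a"
      proof -
        have "a * lin (workload_wt k) x \<le> exp (a * lin (workload_wt k) x)" using exp_ge_add_one_self[of "a * lin (workload_wt k) x"] by linarith
        also have "\<dots> \<le> W x" unfolding W_def using k by (intro member_le_sum) auto
        also note WB
        finally show ?thesis using a by (simp add: pos_le_divide_eq mult.commute)
      qed
      finally have "real (x k) \<le> beta k * (visits k * (B / a))" using beta_pos[of k] visits by simp
      also have "\<dots> = (beta k * visits k) * (B / a)" by simp
      also have "\<dots> \<le> (\<Sum>k\<in>UNIV. beta k * visits k) * (B / a)"
      proof (intro mult_right_mono)
        have "0 \<le> visits k" for k unfolding visits_def by (intro sum_nonneg G_killed_nonneg)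
        then show "beta k * visits k \<le> (\<Sum>k\<in>UNIV. beta k * visits k)"
          using beta_pos by (intro member_le_sum) (auto simp: less_imp_le)
        have "0 \<le> W x" unfolding W_def by (simp add: sum_nonneg)
        then show "0 \<le> B / a" using WB a by simp
      qed
      finally show "real (x k) \<le> (\<Sum>k\<in>UNIV. beta k * visits k) * (B / a)" .
    qed
    show "gen twisted W x \<le> K - \<kappa> * W x" if "0 < x i" for x
      using lyap[of x] that unfolding W_def by blast
  qed (use twisted_nonneg c_bounds drift_c c_moves K eps in auto)
  then obtain \<psi> where fin: "finite {x. \<psi> x \<noteq> 0}" and nn: "\<And>x. 0 \<le> \<psi> x" and nz: "\<exists>x. \<psi> x \<noteq> 0"
    and supp: "\<And>x. \<psi> x \<noteq> 0 \<Longrightarrow> N \<le> real (x i)"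
    and sub: "\<And>x. 0 < x i \<Longrightarrow> \<psi> x \<noteq> 0 \<Longrightarrow> - \<epsilon> * \<psi> x \<le> gen twisted \<psi> x"
    by blast
  define f where "f x = F x * \<psi> x" for x
  have fz: "f x \<noteq> 0 \<longleftrightarrow> \<psi> x \<noteq> 0" for x using F_pos[of x] by (simp add: f_def)
  have f0: "0 \<le> f x" for x using F_pos[of x] nn[of x] by (simp add: f_def)
  have "- (decay + \<epsilon>) * f x \<le> gen q f x" for x
  proof (cases "\<psi> x = 0")
    case True
    then have "f x = 0" using fz by blast
    \<comment> \<open>Off the support \<open>f\<close> attains its minimum 0, so its generator is
      nonnegative; this includes the states with queue \<open>i\<close> empty.\<close>
    moreover have "gen q (\<lambda>_. 0) x \<le> gen q f x"
      by (rule gen_mono_at) (use q_nonneg f0 \<open>f x = 0\<close> in auto)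
    moreover have "gen q (\<lambda>_. 0) x = 0" unfolding gen_def by (simp cong: if_cong)
    ultimately show ?thesis by simp
  next
    case False
    have "0 < N" unfolding N_def of_nat_0_less_iff by simp
    then have xi: "0 < x i" using supp[OF False] by linarith
    have "F x * (- \<epsilon> * \<psi> x) \<le> F x * gen twisted \<psi> x"
      using sub[of x] xi False F_pos[of x] by (intro mult_left_mono) auto
    moreover have "gen q f x = F x * (gen twisted \<psi> x - decay * \<psi> x)"
      unfolding f_def using xi by (rule gen_twist)
    ultimately show ?thesis by (simp add: f_def algebra_simps)
  qed
  moreover have "f e = 0" if "e \<in> E" for e
    using N[OF that] supp[of e] fz[of e] by fastforce
  ultimately show ?thesis using fin nz f0 fz by (intro exI[of _ f]) auto
qed

text \<open>The bound for \<open>decay + \<epsilon>\<close> with small \<open>\<epsilon>\<close>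
  passes to the limit after taking logarithms.\<close>

lemma exp_decay_le: "exp (- decay) \<le> ess_spec_radius lam mu P"
proof -
  define R where "R = ess_spec_radius lam mu P"
  have le: "exp (- (decay + \<epsilon>)) \<le> R" if "0 < \<epsilon>" "\<epsilon> \<le> 1" for \<epsilon>
    unfolding R_def
    by (rule exp_le_ess_spec_radius)
      (use lam_nonneg mu_pos P_nonneg p0_nonneg P_diag decay_le that test_function[OF _ that(1)]
        in \<open>auto simp: less_imp_le\<close>)
  \<comment> \<open>Positivity has to come first for \<open>ln R\<close> to be meaningful.\<close>
  have "0 < R" using le[of 1] less_le_trans[OF exp_gt_zero] by simp
  then have "- decay \<le> ln R + \<epsilon>" if "0 < \<epsilon>" for \<epsilon>
    using le[of "min 1 \<epsilon>"] that by (simp add: ln_ge_iff[symmetric])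
  then have "- decay \<le> ln R" by (rule field_le_epsilon)
  then show ?thesis using \<open>0 < R\<close> by (simp add: ln_ge_iff R_def)
qed

end

text \<open>The exponentiated form includes positivity of the radius, so applying \<open>ln\<close>
  yields the logarithmic bound.\<close>

theorem theorem2p3:
  fixes lam mu nu :: "'d::finite \<Rightarrow> real" and P :: "real^'d^'d"
  assumes lam_nonneg: "\<forall>i. 0 \<le> lam i"
    and mu_pos: "\<forall>i. 0 < mu i"
    and P_nonneg: "\<forall>i j. 0 \<le> P$i$j"
    and P_diag: "\<forall>i. P$i$i = 0"
    and P_substoch: "\<forall>i. (\<Sum>j\<in>UNIV. P$i$j) \<le> 1"
    and hypA: "jackson_irreducible lam mu P"
    and traffic: "\<forall>j. nu j = lam j + (\<Sum>i\<in>UNIV. nu i * P$i$j)"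
    and hypB: "\<forall>i. nu i < mu i"
  shows "exp (- Min (range (\<lambda>i. (sqrt (mu i) - sqrt (nu i))\<^sup>2 / (matrix_inv (mat 1 - P))$i$i)))
           \<le> ess_spec_radius lam mu P"
proof -
  interpret jackson_network lam mu nu P
    by unfold_locales (use assms in blast)+
  let ?g = "\<lambda>i. (sqrt (mu i) - sqrt (nu i))\<^sup>2 / (matrix_inv (mat 1 - P))$i$i"
  \<comment> \<open>An index attaining the minimum serves as the bottleneck.\<close>
  have "Min (range ?g) \<in> range ?g" by (intro Min_in) auto
  then obtain i where i: "Min (range ?g) = ?g i" by (rule rangeE)
  have "?g i \<le> ?g j" for j unfolding i[symmetric] by (intro Min_le) auto
  then interpret jackson_bottleneck lam mu nu P i
    by unfold_locales (simp add: G_def)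
  show ?thesis using exp_decay_le unfolding i decay_def G_def .
qed

end
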